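(* Let $a, d_1,\dots,d_k$ be positive integers ($k\ge 1$), and let $D_a(d_1,\dots,d_k)$ be the generalized Douglas region defined in the context, satisfying the standing assumptions (the diagonal $\ell'$ passes through white unit squares, and the southwestern and northeastern boundaries do not intersect). Let $w$ be its width and $\mathcal{C}$ its number of regular cells. Assume that the vertices $B$ and $D$ lie on the same horizontal line. Then the number of tilings of $D_a(d_1,\dots,d_k)$ is $$\operatorname{M}(D_a(d_1,\dots,d_k)) = 2^{\mathcal{C}-w(w+1)/2}.$$
   Context: Work in the square lattice of the plane. A "diagonal" means a southwest-to-northeast lattice line $x-y=c$ with $c\in\mathbb{Z}$; the unit of distance between diagonals is $\sqrt2/2$, so consecutive diagonals are at distance $1$. Fix two diagonals $\ell$ and $\ell'$, with $\ell'$ below $\ell$, at distance $d_1+\dots+d_k$ apart. Draw in $k-1$ diagonals strictly between them so that the distance from $\ell$ to the top drawn-in diagonal is $d_1$, the distances between successive drawn-in diagonals (from the top) are $d_2,\dots,d_{k-1}$, and the distance from the bottom drawn-in diagonal to $\ell'$ is $d_k$. Drawn-in diagonals cut the unit squares they cross into two triangles. This gives a new lattice whose fundamental regions ("cells") are unit squares and right triangles, the triangles occurring only along drawn-in diagonals. Color the cells black and white so that cells sharing an edge have opposite colors and the cells crossed by $\ell$ are white. Region $D_a(d_1,\dots,d_k)$: Start at a lattice point $A$ on $\ell$ and take unit steps south or east, each step chosen so that the cell on its right is black, until reaching a lattice point $B$ on $\ell'$; this path is the northeastern boundary. Let $D$ be the lattice point on $\ell$ to the left of $A$ with $|AD|=a\sqrt2$.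 The southwestern boundary is obtained by reflecting the northeastern boundary across the perpendicular bisector of $AD$ (reversing step directions); it meets $\ell'$ at a point $C$. Join $D$ to $A$ by a zigzag lattice path of alternating east and north steps starting with a north step, and join $B$ to $C$ by a zigzag path of alternating west and south steps starting with a south step. The region enclosed by these four boundary paths is the generalized Douglas region $D_a(d_1,\dots,d_k)$, with vertices $A,B,C,D$. Standing assumptions: $\ell'$ passes through white unit squares, and the southwestern and northeastern boundaries do not intersect. A tile is the union of two cells sharing an edge; a tiling is a covering of the region by tiles without gaps or overlaps; $\operatorname{M}(R)$ is the number of tilings of $R$. Triangular cells are "up-pointing" if they point away from $\ell'$ and "down-pointing" if they point toward $\ell'$. A cell is regular if it is a black square or a black up-pointing triangle. The width is $w=|BC|/\sqrt2$, the number of white squares in the bottom line of cells. Special cases: for $k=1$, $a=d_1=n$ the region is the Aztec diamond of order $n$ (all unit squares inside $|x|+|y|=n+1$). *)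

theory Defs
  imports Complex_Main
begin

(* Lattice points are pairs (x,y) of integers.  The unit square with lower-left corner (i,j)
   is [i,i+1] x [j,j+1]; it is crossed by the diagonal x - y = i - j (its "level").
   A diagonal  x - y = c  lies below (south-east of)  x - y = c'  iff  c > c', and the
   distance between them (in units sqrt 2 / 2) is |c - c'|.

   The diagonal l is the one through the vertex A, i.e. level  fst A - snd A.
   ds = [d_1,...,d_k].  Drawn-in diagonals: levels  c0 + (d_1+...+d_s), 1 <= s < k.
   l' : level  c0 + (d_1+...+d_k). *)

datatype cell =
    Sq int int     (* a whole unit square with lower-left corner (i,j) *)
  | UpT int int    (* the upper-left triangle of square (i,j) (cut by a drawn-in diagonal);
                      it points away from l', i.e. it is "up-pointing" *)
  | DnT int int    (* the lower-right ("down-pointing") triangle of square (i,j) *)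

definition lev0 :: "int \<times> int \<Rightarrow> int" where
  "lev0 A = fst A - snd A"

definition drawn_levels :: "int \<times> int \<Rightarrow> nat list \<Rightarrow> int set" where
  "drawn_levels A ds = {lev0 A + int (sum_list (take s ds)) | s. 1 \<le> s \<and> s < length ds}"

definition nb_above :: "int \<times> int \<Rightarrow> nat list \<Rightarrow> int \<Rightarrow> nat" where
  "nb_above A ds c = card {l \<in> drawn_levels A ds. l < c}"

(* The black/white colouring: neighbouring cells have opposite colours and the cells
   crossed by l (squares of level lev0 A) are white.  (Explicit formula for this colouring.) *)
fun black :: "int \<times> int \<Rightarrow> nat list \<Rightarrow> cell \<Rightarrow> bool" where
  "black A ds (Sq i j) = odd (i + j - lev0 A + int (nb_above A ds (i - j)))"
| "black A ds (UpT i j) = odd (i + j - lev0 A + int (nb_above A ds (i - j)))"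
| "black A ds (DnT i j) = even (i + j - lev0 A + int (nb_above A ds (i - j)))"

fun cell_edges :: "cell \<Rightarrow> (int \<times> int) set set" where
  "cell_edges (Sq i j) = {{(i,j),(i+1,j)}, {(i,j),(i,j+1)}, {(i+1,j),(i+1,j+1)}, {(i,j+1),(i+1,j+1)}}"
| "cell_edges (UpT i j) = {{(i,j),(i,j+1)}, {(i,j+1),(i+1,j+1)}, {(i,j),(i+1,j+1)}}"
| "cell_edges (DnT i j) = {{(i,j),(i+1,j)}, {(i+1,j),(i+1,j+1)}, {(i,j),(i+1,j+1)}}"

definition adjacent :: "cell \<Rightarrow> cell \<Rightarrow> bool" where
  "adjacent c d \<longleftrightarrow> c \<noteq> d \<and> cell_edges c \<inter> cell_edges d \<noteq> {}"

definition cell_right :: "int \<times> int \<Rightarrow> nat list \<Rightarrow> int \<Rightarrow> int \<Rightarrow> cell" where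
  "cell_right A ds i j = (if i - j \<in> drawn_levels A ds then DnT i j else Sq i j)"

definition cell_top :: "int \<times> int \<Rightarrow> nat list \<Rightarrow> int \<Rightarrow> int \<Rightarrow> cell" where
  "cell_top A ds i j = (if i - j \<in> drawn_levels A ds then UpT i j else Sq i j)"

(* Northeastern boundary: from A, unit steps south or east such that the cell on the right
   of the step is black.  A south step from (x,y) has the cell of square (x-1,y-1) containing
   its right edge on its right; an east step has the cell of square (x,y-1) containing its
   top edge on its right.  These two cells share an edge, so exactly one of them is black. *)
fun ne_point :: "int \<times> int \<Rightarrow> nat list \<Rightarrow> nat \<Rightarrow> int \<times> int" where
  "ne_point A ds 0 = A"
| "ne_point A ds (Suc t) =
     (let (x, y) = ne_point A ds t in
        if black A ds (cell_right A ds (x - 1) (y - 1)) then (x, y - 1)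
        else if black A ds (cell_top A ds x (y - 1)) then (x + 1, y)
        else undefined)"

definition vD :: "int \<times> int \<Rightarrow> nat \<Rightarrow> int \<times> int" where
  "vD A a = (fst A - int a, snd A - int a)"

(* reflection across the perpendicular bisector of AD *)
definition reflect :: "int \<times> int \<Rightarrow> nat \<Rightarrow> int \<times> int \<Rightarrow> int \<times> int" where
  "reflect A a p = (fst A + snd A - int a - snd p, fst A + snd A - int a - fst p)"

definition sw_point :: "int \<times> int \<Rightarrow> nat \<Rightarrow> nat list \<Rightarrow> nat \<Rightarrow> int \<times> int" where
  "sw_point A a ds t = reflect A a (ne_point A ds t)"

definition vB :: "int \<times> int \<Rightarrow> nat list \<Rightarrow> int \<times> int" where
  "vB A ds = ne_point A ds (sum_list ds)"

definition vC :: "int \<times> int \<Rightarrow> nat \<Rightarrow> nat list \<Rightarrow> int \<times> int" where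
  "vC A a ds = sw_point A a ds (sum_list ds)"

(* width w = |BC| / sqrt 2 *)
definition width :: "int \<times> int \<Rightarrow> nat \<Rightarrow> nat list \<Rightarrow> nat" where
  "width A a ds = nat (fst (vB A ds) - fst (vC A a ds))"

(* The closed boundary path D -> A (zigzag) -> B (NE boundary) -> C (zigzag) -> D (SW boundary,
   traversed backwards), as the list of its lattice points (first = last = D). *)
definition boundary :: "int \<times> int \<Rightarrow> nat \<Rightarrow> nat list \<Rightarrow> (int \<times> int) list" where
  "boundary A a ds =
     (let D = vD A a; B = vB A ds; w = width A a ds; n = sum_list ds in
        concat (map (\<lambda>m. [(fst D + int m, snd D + int m), (fst D + int m, snd D + int m + 1)]) [0..<a])
      @ map (ne_point A ds) [0..<Suc n]
      @ concat (map (\<lambda>m. [(fst B - int m, snd B - int m - 1), (fst B - int m - 1, snd B - int m - 1)]) [0..<w])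
      @ map (sw_point A a ds) (rev [0..<n]))"

(* vertical unit edges of a lattice path; (x,y) stands for the segment (x,y)--(x,y+1) *)
definition vert_edges :: "(int \<times> int) list \<Rightarrow> (int \<times> int) set" where
  "vert_edges ps = {(fst p, min (snd p) (snd q)) | p q. (p, q) \<in> set (zip ps (tl ps)) \<and> fst p = fst q \<and> snd p \<noteq> snd q}"

(* unit square (i,j) lies in the region enclosed by the closed lattice path ps:
   the horizontal ray from its centre going east crosses ps an odd number of times *)
definition encloses :: "(int \<times> int) list \<Rightarrow> int \<Rightarrow> int \<Rightarrow> bool" where
  "encloses ps i j \<longleftrightarrow> odd (card {x. x > i \<and> (x, j) \<in> vert_edges ps})"

definition douglas :: "int \<times> int \<Rightarrow> nat \<Rightarrow> nat list \<Rightarrow> cell set" where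
  "douglas A a ds =
     {Sq i j | i j. encloses (boundary A a ds) i j \<and> i - j \<notin> drawn_levels A ds}
   \<union> {UpT i j | i j. encloses (boundary A a ds) i j \<and> i - j \<in> drawn_levels A ds}
   \<union> {DnT i j | i j. encloses (boundary A a ds) i j \<and> i - j \<in> drawn_levels A ds}"

definition is_tiling :: "cell set \<Rightarrow> cell set set \<Rightarrow> bool" where
  "is_tiling R T \<longleftrightarrow>
     (\<forall>t\<in>T. \<exists>c d. t = {c, d} \<and> c \<in> R \<and> d \<in> R \<and> adjacent c d)
   \<and> (\<forall>c\<in>R. \<exists>!t. t \<in> T \<and> c \<in> t)"

definition num_tilings :: "cell set \<Rightarrow> nat" where
  "num_tilings R = card {T. is_tiling R T}"

fun regular :: "int \<times> int \<Rightarrow> nat list \<Rightarrow> cell \<Rightarrow> bool" where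
  "regular A ds (Sq i j) = black A ds (Sq i j)"
| "regular A ds (UpT i j) = black A ds (UpT i j)"
| "regular A ds (DnT i j) = False"

definition num_regular :: "int \<times> int \<Rightarrow> nat \<Rightarrow> nat list \<Rightarrow> nat" where
  "num_regular A a ds = card {c \<in> douglas A a ds. regular A ds c}"

end

theory Submission
  imports Defs
begin

text \<open>
  The rows of cells are alternately white and black. Record for every row the set of white cells that
  are matched downwards. A tiling is then a sequence of such sets, and passing from one set to the next
  is one of two kinds of moves, according to whether the northeastern boundary makes an east or a south
  step: both are given by shifting elements (respectively non-elements) injectively by 0 or 1. The
  boundary word therefore acts as a product of two operators \<open>E\<close> and \<open>S\<close>. They satisfy \<open>ES = 2 SE\<close>,
  and the sorted word \<open>S\<^sup>a E\<^sup>w\<close> has exactly one sequence, so the number of tilings is \<open>2\<close> to the number of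
  pairs consisting of an east step and a later south step. Each regular row has an east step on its
  boundary, and counting the cells of these rows gives \<open>w (w + 1) / 2\<close> plus the same number of pairs.
\<close>

section \<open>The two moves and their commutation\<close>

text \<open>
  Sets are encoded by characteristic lists. \<open>shift False S U\<close> says that \<open>U\<close> arises from \<open>S\<close> by moving
  each element by 0 or 1 to the right without collisions; the flag \<open>c\<close> tells that an element moves
  into the first position of the window. Given \<open>S\<close> and \<open>U\<close>, the moves are determined.
\<close>

fun shift :: "bool \<Rightarrow> bool list \<Rightarrow> bool list \<Rightarrow> bool" where
  "shift c [] [] \<longleftrightarrow> \<not> c"
| "shift c [] (u # U) \<longleftrightarrow> False"
| "shift c (s # S) [] \<longleftrightarrow> False"
| "shift c (s # S) (u # U) \<longleftrightarrow>
     (if s then if c then u \<and> shift True S U else shift (\<not> u) S U else u = c \<and> shift False S U)"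

lemma shift_length: "shift c S U \<Longrightarrow> length U = length S"
  by (induction c S U rule: shift.induct) (auto split: if_splits)

lemma finite_length_eq: "finite {U :: bool list. length U = n}"
  using finite_lists_length_eq[of "UNIV :: bool set" n] by simp

lemma finite_shift: "finite {U. shift c S U}"
proof (rule finite_subset)
  show "{U. shift c S U} \<subseteq> {U. length U = length S}"
    by (auto simp: shift_length)
qed (rule finite_length_eq)

lemma card_bool_list_split:
  assumes "finite {Z. P Z}" and "\<not> P []"
  shows "card {Z. P Z} = card {Z. P (True # Z)} + card {Z. P (False # Z)}"
proof -
  have eq: "{Z. P Z} = Cons True ` {Z. P (True # Z)} \<union> Cons False ` {Z. P (False # Z)}" (is "_ = ?L \<union> ?R")
  proof (intro set_eqI iffI)
    fix Z assume "Z \<in> {Z. P Z}"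
    with assms(2) show "Z \<in> ?L \<union> ?R"
      by (cases Z; cases "hd Z") auto
  qed auto
  have "finite ?L" "finite ?R"
    using assms(1) unfolding eq by auto
  then have "card {Z. P Z} = card ?L + card ?R"
    unfolding eq by (intro card_Un_disjoint) auto
  then show ?thesis
    by (simp add: card_image)
qed

text \<open>Numbers of intermediate states when a part of the window on the left is already
  processed; \<open>c\<close> and \<open>b\<close> are the carries of the east and of the south move
  across the cut. The south move acts on non-elements, hence the negations.\<close>

definition east_south :: "bool \<Rightarrow> bool \<Rightarrow> bool list \<Rightarrow> bool list \<Rightarrow> nat" where
  "east_south c b Z Y = card {W. shift c (Z @ [False]) W \<and> shift b (map Not W) (map Not Y)}"

definition south_east :: "bool \<Rightarrow> bool \<Rightarrow> bool list \<Rightarrow> bool list \<Rightarrow> nat" where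
  "south_east c b Z Y = card {W. shift b (map Not Z) (map Not W) \<and> shift c (W @ [False]) Y}"

lemma finite_shift_Not: "finite {W. shift b S (map Not W)}"
proof (rule finite_subset)
  show "{W. shift b S (map Not W)} \<subseteq> {W. length W = length S}"
    by (auto dest: shift_length)
qed (rule finite_length_eq)

lemma east_south_Cons:
  "east_south c b (z # Z) (y # Y) =
     card {W. shift c (z # Z @ [False]) (True # W) \<and> shift b (map Not (True # W)) (map Not (y # Y))}
   + card {W. shift c (z # Z @ [False]) (False # W) \<and> shift b (map Not (False # W)) (map Not (y # Y))}"
  using card_bool_list_split[of "\<lambda>W. shift c ((z # Z) @ [False]) W \<and> shift b (map Not W) (map Not (y # Y))"]
  by (simp only: east_south_def append_Cons finite_Collect_conjI finite_shift list.map shift.simps simp_thms)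

lemma south_east_Cons:
  "south_east c b (z # Z) (y # Y) =
     card {W. shift b (map Not (z # Z)) (map Not (True # W)) \<and> shift c (True # W @ [False]) (y # Y)}
   + card {W. shift b (map Not (z # Z)) (map Not (False # W)) \<and> shift c (False # W @ [False]) (y # Y)}"
  using card_bool_list_split[of "\<lambda>W. shift b (map Not (z # Z)) (map Not W) \<and> shift c (W @ [False]) (y # Y)"]
  by (simp only: south_east_def append_Cons finite_Collect_conjI finite_shift_Not list.map shift.simps simp_thms)

text \<open>Column-by-column proof of \<open>ES = 2 SE\<close>: these linear relations between the counts for the four carry
  states reproduce themselves when a column is added on the left.\<close>

lemma east_south_vs_south_east:
  assumes "length Y = Suc (length Z)"
  shows "east_south False False Z Y + east_south True True Z Y = 2 * south_east False False Z Y
    \<and> east_south False False Z Y = east_south True True Z Y + 2 * south_east True True Z Y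
    \<and> east_south True False Z Y = south_east True False Z Y
    \<and> east_south False True Z Y = 2 * south_east False True Z Y"
  using assms
proof (induction Z arbitrary: Y)
  case Nil
  then obtain y where Y: "Y = [y]" by (cases Y) auto
  have 1: "shift c [False] W \<longleftrightarrow> W = [c]" for c W
    by (cases W; cases "tl W") auto
  have 2: "shift b [] (map Not W) \<longleftrightarrow> W = [] \<and> \<not> b" for b W
    by (cases W) auto
  show ?case
    unfolding east_south_def south_east_def Y append_Nil list.map(1) 1 2
    by (cases y) (auto simp: Collect_conv_if conj_commute)
next
  case (Cons z Z)
  then obtain y Y' where Y: "Y = y # Y'" and l: "length Y' = Suc (length Z)" by (cases Y) auto
  note IH = Cons.IH[OF l, THEN conjunct1] Cons.IH[OF l, THEN conjunct2, THEN conjunct1]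
    Cons.IH[OF l, THEN conjunct2, THEN conjunct2, THEN conjunct1]
    Cons.IH[OF l, THEN conjunct2, THEN conjunct2, THEN conjunct2]
  \<comment> \<open>For each value of \<open>(z, y)\<close>, fixing the first bit of
    \<open>W\<close> turns every count into counts for \<open>Z\<close> and \<open>Y'\<close> with
    new carries, or into zero; the rest is linear in the induction hypotheses.\<close>
  show ?case unfolding Y east_south_Cons south_east_Cons
    by (cases z; cases y; intro conjI)
      (simp_all flip: east_south_def south_east_def, (use IH in linarith)+)
qed

text \<open>The south move drops the first column of its window, so this column is peeled off first.
  If it holds an element, the east move keeps it or carries it, which leaves the carries
  \<open>False False\<close> and \<open>True True\<close>; otherwise only \<open>False True\<close>
  is left. These are the first and the last relation of
  \<open>east_south_vs_south_east\<close>.\<close>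

lemma card_east_south:
  assumes "Z \<noteq> []"
  shows "card {W. shift False (Z @ [False]) W \<and> shift False (map Not W) (False # map Not Y)}
       = 2 * card {W. shift False (map Not Z) (False # map Not W) \<and> shift False (W @ [False]) Y}"
proof (cases "length Y = length Z")
  case False
  then have "{W. shift False (Z @ [False]) W \<and> shift False (map Not W) (False # map Not Y)} = {}"
    and "{W. shift False (map Not Z) (False # map Not W) \<and> shift False (W @ [False]) Y} = {}"
    by (auto dest!: shift_length)
  then show ?thesis by (simp only: card.empty mult_0_right)
next
  case True
  obtain z Z' where Z: "Z = z # Z'" using assms by (cases Z) auto
  have l: "length Y = Suc (length Z')" using True Z by simp
  have "card {W. shift False (Z @ [False]) W \<and> shift False (map Not W) (False # map Not Y)}
      = card {W. shift False (Z @ [False]) (True # W) \<and> shift False (map Not (True # W)) (False # map Not Y)}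
      + card {W. shift False (Z @ [False]) (False # W) \<and> shift False (map Not (False # W)) (False # map Not Y)}"
    by (rule card_bool_list_split[of "\<lambda>W. shift False (Z @ [False]) W \<and> shift False (map Not W) (False # map Not Y)"])
      (simp_all only: finite_Collect_conjI finite_shift list.map shift.simps simp_thms)
  moreover have "east_south False False Z' Y + east_south True True Z' Y = 2 * south_east False False Z' Y"
    "east_south False True Z' Y = 2 * south_east False True Z' Y"
    using east_south_vs_south_east[OF l] by blast+
  ultimately show ?thesis
    unfolding Z by (cases z) (simp_all flip: east_south_def south_east_def)
qed

text \<open>In step words, \<open>True\<close> is an east step and \<open>False\<close> a south step.\<close>

fun walks :: "bool list \<Rightarrow> bool list \<Rightarrow> nat" where
  "walks [] Z = (if True \<in> set Z then 0 else 1)"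
| "walks (True # s) Z = (\<Sum>W | shift False (Z @ [False]) W. walks s W)"
| "walks (False # s) Z = (\<Sum>W | shift False (map Not Z) (False # map Not W). walks s W)"

lemma finite_shift_False_Not: "finite {W. shift b S (False # map Not W)}"
proof (rule finite_subset)
  show "{W. shift b S (False # map Not W)} \<subseteq> {W. length W = length S - 1}"
    by (auto dest: shift_length)
qed (rule finite_length_eq)

lemma sum_sum_eq_card:
  fixes f :: "'b \<Rightarrow> nat"
  assumes "finite {W. P W}" "\<And>W. finite {Y. Q W Y}"
  shows "(\<Sum>W | P W. \<Sum>Y | Q W Y. f Y) = (\<Sum>Y \<in> (\<Union>W\<in>{W. P W}. {Y. Q W Y}). card {W. P W \<and> Q W Y} * f Y)"
proof -
  let ?B = "\<Union>W\<in>{W. P W}. {Y. Q W Y}"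
  have fin: "finite ?B" using assms by auto
  have "(\<Sum>W | P W. \<Sum>Y | Q W Y. f Y) = (\<Sum>W | P W. \<Sum>Y | Y \<in> ?B \<and> Q W Y. f Y)"
    by (intro sum.cong) auto
  also have "\<dots> = (\<Sum>Y\<in>?B. \<Sum>W | W \<in> {W. P W} \<and> Q W Y. f Y)"
    using assms(1) fin by (rule sum.swap_restrict)
  finally show ?thesis by simp
qed

lemma walks_swap:
  assumes "Z \<noteq> []"
  shows "walks (True # False # s) Z = 2 * walks (False # True # s) Z"
proof -
  let ?P = "\<lambda>W. shift False (Z @ [False]) W" and ?Q = "\<lambda>W Y. shift False (map Not W) (False # map Not Y)"
  let ?P' = "\<lambda>W. shift False (map Not Z) (False # map Not W)" and ?Q' = "\<lambda>W Y. shift False (W @ [False]) Y"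
  let ?B = "\<Union>W\<in>{W. ?P W}. {Y. ?Q W Y}" and ?B' = "\<Union>W\<in>{W. ?P' W}. {Y. ?Q' W Y}"
  have c: "card {W. ?P W \<and> ?Q W Y} = 2 * card {W. ?P' W \<and> ?Q' W Y}" for Y
    by (rule card_east_south[OF assms])
  have f1: "finite {W. ?P W \<and> ?Q W Y}" for Y
    by (rule finite_subset[OF _ finite_shift]) auto
  have f2: "finite {W. ?P' W \<and> ?Q' W Y}" for Y
    by (rule finite_subset[OF _ finite_shift_False_Not]) auto
  \<comment> \<open>The numbers of intermediate states differ by the factor 2, so one vanishes
    exactly if the other does, and both orders of the moves reach the same ends.\<close>
  have "Y \<in> ?B \<longleftrightarrow> Y \<in> ?B'" for Y
    using c[of Y] card_0_eq[OF f1[of Y]] card_0_eq[OF f2[of Y]] by auto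
  then have B: "?B = ?B'" by blast
  have "walks (True # False # s) Z = (\<Sum>Y\<in>?B. card {W. ?P W \<and> ?Q W Y} * walks s Y)"
    by (simp add: sum_sum_eq_card finite_shift finite_shift_False_Not)
  also have "\<dots> = 2 * (\<Sum>Y\<in>?B'. card {W. ?P' W \<and> ?Q' W Y} * walks s Y)"
    unfolding c B sum_distrib_left by (simp add: mult.assoc)
  also have "\<dots> = 2 * walks (False # True # s) Z"
    by (simp add: sum_sum_eq_card finite_shift finite_shift_False_Not)
  finally show ?thesis .
qed

text \<open>The south step is exchanged with the \<open>e\<close> east steps one after the other,
  each time for a factor 2.\<close>

lemma walks_move_south_front:
  assumes "Z \<noteq> []"
  shows "walks (replicate e True @ False # s) Z = 2 ^ e * walks (False # replicate e True @ s) Z"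
  using assms
proof (induction e arbitrary: Z)
  case (Suc e)
  have "walks (replicate (Suc e) True @ False # s) Z =
      (\<Sum>W | shift False (Z @ [False]) W. walks (replicate e True @ False # s) W)"
    by simp
  also have "\<dots> = (\<Sum>W | shift False (Z @ [False]) W. 2 ^ e * walks (False # replicate e True @ s) W)"
  proof (rule sum.cong)
    fix W assume "W \<in> {W. shift False (Z @ [False]) W}"
    then have "W \<noteq> []" by (auto dest: shift_length)
    then show "walks (replicate e True @ False # s) W = 2 ^ e * walks (False # replicate e True @ s) W"
      by (rule Suc.IH)
  qed simp
  also have "\<dots> = 2 ^ e * walks (True # False # replicate e True @ s) Z"
    by (simp only: sum_distrib_left walks.simps)
  also have "\<dots> = 2 ^ Suc e * walks (False # replicate (Suc e) True @ s) Z"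
    by (subst walks_swap[OF Suc.prems]) simp
  finally show ?case .
qed simp

section \<open>Inversions of the step word and lengths of the regular rows\<close>

fun inversions :: "nat \<Rightarrow> bool list \<Rightarrow> nat" where
  "inversions e [] = 0"
| "inversions e (True # s) = inversions (Suc e) s"
| "inversions e (False # s) = e + inversions e s"

lemma shift_replicate_False: "shift False (replicate k False) U \<longleftrightarrow> U = replicate k False"
proof (induction k arbitrary: U)
  case 0 then show ?case by (cases U) auto
next
  case (Suc k) then show ?case by (cases U) auto
qed

lemma walks_empty: "walks (replicate e True) (replicate k False) = 1"
proof (induction e arbitrary: k)
  case (Suc e)
  have "{W. shift False (replicate k False @ [False]) W} = {replicate (Suc k) False}"
    using shift_replicate_False[of "Suc k"] by (simp add: replicate_append_same)
  then show ?case using Suc[of "Suc k"] by simp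
qed simp

text \<open>The \<open>e\<close> leading steps are the east steps already read by
  \<open>inversions\<close>. The next south step moves in front of them for a factor
  \<open>2 ^ e\<close>; on a full state it has a single successor, as there are no non-elements to
  move, namely the full state with one element fewer. Since there are as many elements as south
  steps, in the end only east steps from the empty list are left, and these allow one walk.\<close>

lemma walks_full:
  assumes "count_list s False = m"
  shows "walks (replicate e True @ s) (replicate m True) = 2 ^ inversions e s"
  using assms
proof (induction e s arbitrary: m rule: inversions.induct)
  case (1 e)
  then show ?case using walks_empty[of e 0] by simp
next
  case (2 e s)
  then show ?case using "2.IH"[of m] by (simp add: replicate_append_same[symmetric])
next
  case (3 e s)
  then obtain k where m: "m = Suc k" and k: "count_list s False = k" by auto
  have Not_W: "map Not W = replicate k False \<longleftrightarrow> W = replicate k True" for W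
    using inj_map_eq_map[of Not W "replicate k True"] by (simp add: inj_def)
  have "{W. shift False (map Not (replicate m True)) (False # map Not W)} = {replicate k True}"
    unfolding m by (simp add: shift_replicate_False Not_W)
  then have "walks (False # replicate e True @ s) (replicate m True) = walks (replicate e True @ s) (replicate k True)"
    by simp
  also have "\<dots> = 2 ^ inversions e s"
    by (rule "3.IH"[OF k])
  finally have "walks (False # replicate e True @ s) (replicate m True) = 2 ^ inversions e s" .
  moreover have "walks (replicate e True @ False # s) (replicate m True)
      = 2 ^ e * walks (False # replicate e True @ s) (replicate m True)"
    by (rule walks_move_south_front) (simp add: m)
  ultimately show ?case
    by (simp only: inversions.simps power_add)
qed

text \<open>\<open>m\<close> is the length of the current row. An east step enters a regular row
  that is one cell longer, a south step an uncounted row that is one cell shorter.\<close>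

fun regular_count :: "nat \<Rightarrow> bool list \<Rightarrow> nat" where
  "regular_count m [] = 0"
| "regular_count m (True # s) = Suc m + regular_count (Suc m) s"
| "regular_count m (False # s) = regular_count (m - 1) s"

lemma inversions_plus: "inversions e s = e * count_list s False + inversions 0 s"
proof -
  have "inversions (d + e) s = e * count_list s False + inversions d s" for d
    by (induction d s arbitrary: e rule: inversions.induct) (auto simp: algebra_simps)
  from this[of 0] show ?thesis by simp
qed

text \<open>The row entered by the \<open>i\<close>-th east step has length \<open>e + i\<close>
  plus the number of south steps still to come. Summed over the east steps, this gives a difference
  of two triangular numbers plus the inversions.\<close>

lemma regular_count_inversions:
  "2 * regular_count (count_list s False + e) s + e * (e + 1)
     = (e + count_list s True) * (e + count_list s True + 1) + 2 * inversions 0 s"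
proof (induction s arbitrary: e)
  case (Cons x s)
  show ?case
  proof (cases x)
    case True
    then show ?thesis
      using Cons.IH[of "Suc e"] inversions_plus[of "Suc 0" s] by (simp add: algebra_simps)
  qed (use Cons.IH[of e] in simp)
qed simp

section \<open>Tilings of two consecutive rows\<close>

lemma adjacent_commute: "adjacent c d \<longleftrightarrow> adjacent d c"
  by (auto simp: adjacent_def)

lemma is_tiling_subset_Pow: "is_tiling R T \<Longrightarrow> T \<subseteq> Pow R"
  by (fastforce simp: is_tiling_def)

lemma finite_tilings: "finite R \<Longrightarrow> finite {T. is_tiling R T}"
  by (rule finite_subset[of _ "Pow (Pow R)"]) (auto dest: is_tiling_subset_Pow)

lemma num_tilings_empty: "num_tilings {} = 1"
proof -
  have "{T. is_tiling {} T} = {{}}"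
    by (auto simp: is_tiling_def)
  then show ?thesis by (simp add: num_tilings_def)
qed

lemma is_tiling_insert_tile:
  assumes "c \<notin> R" "d \<in> R" "adjacent c d" "is_tiling (R - {d}) T"
  shows "is_tiling (insert c R) (insert {c, d} T)"
proof -
  have sub: "t \<subseteq> R - {d}" if "t \<in> T" for t
    using is_tiling_subset_Pow[OF assms(4)] that by auto
  show ?thesis
    unfolding is_tiling_def
  proof (intro conjI ballI)
    fix t assume "t \<in> insert {c, d} T"
    then show "\<exists>x y. t = {x, y} \<and> x \<in> insert c R \<and> y \<in> insert c R \<and> adjacent x y"
    proof
      assume "t = {c, d}"
      then show ?thesis using assms by auto
    next
      assume "t \<in> T"
      then obtain x y where "t = {x, y}" "x \<in> R - {d}" "y \<in> R - {d}" "adjacent x y"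
        using assms(4) unfolding is_tiling_def by meson
      then show ?thesis by blast
    qed
  next
    fix x assume x: "x \<in> insert c R"
    show "\<exists>!t. t \<in> insert {c, d} T \<and> x \<in> t"
    proof (cases "x = c \<or> x = d")
      case True
      then show ?thesis using sub assms(1) by (intro ex1I[of _ "{c, d}"]) auto
    next
      case False
      then have "x \<in> R - {d}" using x by auto
      then have "\<exists>!t. t \<in> T \<and> x \<in> t"
        using assms(4) unfolding is_tiling_def by blast
      then show ?thesis using False by auto
    qed
  qed
qed

lemma is_tiling_remove_tile:
  assumes "is_tiling (insert c R) T" "c \<notin> R"
  obtains d T' where "d \<in> R" "adjacent c d" "is_tiling (R - {d}) T'" "T = insert {c, d} T'"
proof -
  have uniq: "\<exists>!t. t \<in> T \<and> x \<in> t" if "x \<in> insert c R" for x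
    using assms(1) that unfolding is_tiling_def by blast
  have tile: "\<exists>x y. t = {x, y} \<and> x \<in> insert c R \<and> y \<in> insert c R \<and> adjacent x y" if "t \<in> T" for t
    using assms(1) that unfolding is_tiling_def by blast
  obtain t where t: "t \<in> T" "c \<in> t" using uniq[of c] by blast
  obtain x y where xy: "t = {x, y}" "x \<in> insert c R" "y \<in> insert c R" "adjacent x y"
    using tile[OF t(1)] by blast
  have "\<exists>d. t = {c, d} \<and> d \<in> R \<and> adjacent c d"
  proof (cases "c = x")
    case True
    then have "y \<noteq> c" using xy(4) by (auto simp: adjacent_def)
    then show ?thesis using xy True by auto
  next
    case False
    then have "c = y" using t(2) xy(1) by auto
    then show ?thesis using xy False adjacent_commute[of x y] by auto
  qed
  then obtain d where d: "t = {c, d}" "d \<in> R" "adjacent c d" by blast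
  have other: "c \<notin> u \<and> d \<notin> u" if "u \<in> T - {t}" for u
    using uniq[of c] uniq[of d] that t d by auto
  have "is_tiling (R - {d}) (T - {t})"
    unfolding is_tiling_def
  proof (intro conjI ballI)
    fix u assume u: "u \<in> T - {t}"
    then obtain x y where "u = {x, y}" "x \<in> insert c R" "y \<in> insert c R" "adjacent x y"
      using tile[of u] by blast
    then show "\<exists>x y. u = {x, y} \<and> x \<in> R - {d} \<and> y \<in> R - {d} \<and> adjacent x y"
      using other[OF u] by auto
  next
    fix x assume x: "x \<in> R - {d}"
    then have "x \<notin> t" using d(1) assms(2) by auto
    moreover have "\<exists>!u. u \<in> T \<and> x \<in> u" using uniq x by auto
    ultimately show "\<exists>!u. u \<in> T - {t} \<and> x \<in> u" by auto
  qed
  moreover have "T = insert {c, d} (T - {t})" using t d by auto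
  ultimately show ?thesis using that d by blast
qed

text \<open>Expansion along one cell: the tile covering \<open>c\<close> contains exactly one
  neighbour \<open>d\<close>, and removing this tile leaves a tiling of
  \<open>R - {d}\<close>.\<close>

lemma num_tilings_insert:
  assumes "finite R" "c \<notin> R"
  shows "num_tilings (insert c R) = (\<Sum>d | d \<in> R \<and> adjacent c d. num_tilings (R - {d}))"
proof -
  let ?F = "\<lambda>d. insert {c, d} ` {T. is_tiling (R - {d}) T}"
  let ?N = "{d. d \<in> R \<and> adjacent c d}"
  have c_notin: "t \<in> T \<Longrightarrow> c \<notin> t" if "is_tiling (R - {d}) T" for d t T
    using is_tiling_subset_Pow[OF that] assms(2) by auto
  have "{T. is_tiling (insert c R) T} = (\<Union>d\<in>?N. ?F d)"
  proof (intro set_eqI iffI)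
    fix T assume "T \<in> {T. is_tiling (insert c R) T}"
    then show "T \<in> (\<Union>d\<in>?N. ?F d)"
      using assms(2) by (auto elim!: is_tiling_remove_tile)
  next
    fix T assume "T \<in> (\<Union>d\<in>?N. ?F d)"
    then show "T \<in> {T. is_tiling (insert c R) T}"
      using assms(2) by (auto intro: is_tiling_insert_tile)
  qed
  moreover have "?F d \<inter> ?F e = {}" if "d \<noteq> e" for d e
  proof -
    have False if "insert {c, d} T = insert {c, e} T'" "is_tiling (R - {d}) T" "is_tiling (R - {e}) T'" for T T'
    proof -
      have "{c, d} = {c, e}" using that c_notin[OF that(3), of "{c, d}"] by blast
      then show False using \<open>d \<noteq> e\<close> by (auto simp: doubleton_eq_iff)
    qed
    then show ?thesis by blast
  qed
  moreover have "card (?F d) = num_tilings (R - {d})" for d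
  proof -
    have "inj_on (insert {c, d}) {T. is_tiling (R - {d}) T}"
    proof (rule inj_onI)
      fix T T' assume a: "T \<in> {T. is_tiling (R - {d}) T}" "T' \<in> {T. is_tiling (R - {d}) T}"
        and eq: "insert {c, d} T = insert {c, d} T'"
      have "{c, d} \<notin> T" "{c, d} \<notin> T'" using a c_notin by blast+
      then show "T = T'" using eq by (metis insert_ident)
    qed
    then show ?thesis by (simp add: card_image num_tilings_def)
  qed
  ultimately show ?thesis
    using assms(1) card_UN_disjoint[of ?N ?F] by (simp add: num_tilings_def finite_tilings)
qed

lemma num_tilings_isolated:
  assumes "finite R" "c \<in> R" "\<And>d. d \<in> R \<Longrightarrow> \<not> adjacent c d"
  shows "num_tilings R = 0"
proof -
  have "num_tilings R = num_tilings (insert c (R - {c}))"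
    using assms(2) by (simp add: insert_absorb)
  also have "\<dots> = (\<Sum>d | d \<in> R - {c} \<and> adjacent c d. num_tilings (R - {c} - {d}))"
    using assms(1) by (intro num_tilings_insert) auto
  also have "{d. d \<in> R - {c} \<and> adjacent c d} = {}"
    using assms(3) by auto
  finally show ?thesis by simp
qed

section \<open>Forced and free matchings between rows of cells\<close>

fun row :: "(int \<Rightarrow> cell) \<Rightarrow> int \<Rightarrow> bool list \<Rightarrow> cell set" where
  "row f i [] = {}"
| "row f i (b # bs) = (if b then insert (f i) (row f (i + 1) bs) else row f (i + 1) bs)"

lemma finite_row [simp]: "finite (row f i bs)"
  by (induction bs arbitrary: i) auto

lemma row_elem: "d \<in> row f i bs \<Longrightarrow> \<exists>j\<ge>i. d = f j"
proof (induction bs arbitrary: i)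
  case (Cons b bs)
  then consider "d = f i" | j where "j \<ge> i + 1" "d = f j"
    using Cons.IH[of "i + 1"] by (auto split: if_splits)
  then show ?case
  proof cases
    case 2
    then show ?thesis by (intro exI[of _ j]) auto
  qed auto
qed simp

lemma row_replicate_True: "row f i (replicate n True) = f ` {i..<i + int n}"
proof (induction n arbitrary: i)
  case (Suc n)
  have "{i..<i + int (Suc n)} = insert i {i + 1..<i + 1 + int n}" by auto
  then show ?case using Suc by simp
qed simp

lemma row_snoc_False: "row f i (bs @ [False]) = row f i bs"
  by (induction bs arbitrary: i) auto

lemma row_eq_empty_iff: "row f i bs = {} \<longleftrightarrow> True \<notin> set bs"
  by (induction bs arbitrary: i) auto

lemma num_tilings_row_independent:
  assumes "\<And>j k. \<not> adjacent (f j) (f k)"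
  shows "num_tilings (row f i bs) = (if True \<in> set bs then 0 else 1)"
proof (cases "True \<in> set bs")
  case True
  then obtain c where c: "c \<in> row f i bs" using row_eq_empty_iff[of f i bs] by auto
  have "num_tilings (row f i bs) = 0"
    using assms row_elem c by (intro num_tilings_isolated[OF _ c]) (auto, metis)
  then show ?thesis using True by simp
next
  case False
  then have "row f i bs = {}" by (simp add: row_eq_empty_iff)
  then show ?thesis using False by (simp add: num_tilings_empty)
qed

text \<open>Meant for the triangles along a drawn-in diagonal, where \<open>bs\<close> marks the
  upper ones already matched upwards. Any other upper triangle has only its lower companion as
  neighbour, so this tile is forced and just the lower triangles marked by \<open>bs\<close>
  survive.\<close>

lemma num_tilings_matched_rows:
  assumes uu: "\<And>j k. \<not> adjacent (u j) (u k)"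
    and ul: "\<And>j k. adjacent (u j) (l k) \<longleftrightarrow> j = k"
    and "inj u" "inj l" "\<And>j k. u j \<noteq> l k"
    and "finite R"
    and "\<And>j. j \<ge> i \<Longrightarrow> u j \<notin> R \<and> l j \<notin> R \<and> (\<forall>d\<in>R. \<not> adjacent (u j) d)"
  shows "num_tilings (row u i (map Not bs) \<union> (row l i (replicate (length bs) True) \<union> R))
       = num_tilings (row l i bs \<union> R)"
  using assms(6,7)
proof (induction bs arbitrary: i R)
  case (Cons b bs)
  show ?case
  proof (cases b)
    case True
    have "num_tilings (row u (i + 1) (map Not bs) \<union> (row l (i + 1) (replicate (length bs) True) \<union> insert (l i) R))
        = num_tilings (row l (i + 1) bs \<union> insert (l i) R)"
      using Cons.prems assms(3-5) ul by (intro Cons.IH) (auto simp: inj_eq)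
    then show ?thesis using True by simp
  next
    case False
    let ?R = "row u (i + 1) (map Not bs) \<union> (row l (i + 1) (replicate (length bs) True) \<union> R)"
    have notin: "u i \<notin> ?R" "l i \<notin> ?R"
      using Cons.prems(2)[of i] assms(3-5) assms(5)[THEN not_sym] by (auto dest!: row_elem simp: inj_eq)
    have "{d. d \<in> insert (l i) ?R \<and> adjacent (u i) d} = {l i}"
      using Cons.prems(2)[of i] uu ul by (auto dest!: row_elem)
    then have "num_tilings (insert (u i) (insert (l i) ?R)) = num_tilings (insert (l i) ?R - {l i})"
      using notin assms(5)[of i i] Cons.prems(1) by (subst num_tilings_insert) auto
    also have "\<dots> = num_tilings ?R"
      using notin by simp
    also have "\<dots> = num_tilings (row l (i + 1) bs \<union> R)"
      using Cons.prems by (intro Cons.IH) auto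
    finally show ?thesis using False by (simp add: insert_commute)
  qed
qed simp

lemma shift_True_hd: "shift True S U \<Longrightarrow> U \<noteq> [] \<and> hd U"
  by (cases S; cases U) (auto split: if_splits)

text \<open>The only neighbours of \<open>l j\<close> are \<open>u j\<close> and
  \<open>u (j + 1)\<close>, so the partners of the cells marked by \<open>S\<close> form a list
  \<open>U\<close> that arises by \<open>shift\<close> and is contained in \<open>X\<close>. As
  \<open>S\<close> and \<open>U\<close> determine the moves, each \<open>U\<close> stands for one
  matching, after which \<open>X\<close> without \<open>U\<close> remains. The flag \<open>c\<close>
  says that the first cell of \<open>X\<close> is already taken from the left: it is missing from
  the region but still belongs to \<open>U\<close>.\<close>

lemma num_tilings_gap:
  assumes ll: "\<And>j k. \<not> adjacent (l j) (l k)"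
    and lu: "\<And>j k. adjacent (l j) (u k) \<longleftrightarrow> k = j \<or> k = j + 1"
    and "inj l" "inj u" "\<And>j k. l j \<noteq> u k"
    and "length X = length S" "c \<Longrightarrow> X \<noteq> [] \<and> hd X" "finite R"
    and "\<And>j. j \<ge> i \<Longrightarrow> l j \<notin> R \<and> u j \<notin> R \<and> (\<forall>d\<in>R. \<not> adjacent (l j) d)"
  shows "num_tilings (row l i S \<union> (row u i (if c then False # tl X else X) \<union> R))
       = (\<Sum>U | shift c S U \<and> list_all2 (\<longrightarrow>) U X.
            num_tilings (row u i (map2 (\<lambda>x v. x \<and> \<not> v) X U) \<union> R))"
  using assms(6-9)
proof (induction S arbitrary: c X i R)
  case Nil
  have "{U. shift c [] U \<and> list_all2 (\<longrightarrow>) U []} = {[]}"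
    using Nil.prems by auto
  then show ?case using Nil.prems by auto
next
  case (Cons s S)
  then obtain x X' where X: "X = x # X'" and len: "length X' = length S" by (cases X) auto
  let ?N = "\<lambda>i X R U. num_tilings (row u i (map2 (\<lambda>x v. x \<and> \<not> v) X U) \<union> R)"
  let ?M = "\<lambda>c. {U. shift c S U \<and> list_all2 (\<longrightarrow>) U X'}"
  \<comment> \<open>The rest for the later columns if \<open>l i\<close> is not joined to
    \<open>u i\<close>: a cell \<open>u i\<close> that is present and not taken from the left is out
    of reach of all later \<open>l j\<close>.\<close>
  let ?R' = "if x \<and> \<not> c then insert (u i) R else R"
  have cx: "c \<Longrightarrow> x" using Cons.prems(2) X by auto
  have R: "finite R" by (rule Cons.prems(3))
  have notin: "l i \<notin> R" "u i \<notin> R" and nonadj: "\<And>d. d \<in> R \<Longrightarrow> \<not> adjacent (l i) d"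
    using Cons.prems(4)[of i] by auto
  have IH: "num_tilings (row l (i + 1) S \<union> (row u (i + 1) (if c' then False # tl X' else X') \<union> R''))
      = (\<Sum>U\<in>?M c'. ?N (i + 1) X' R'' U)"
    if "c' \<Longrightarrow> X' \<noteq> [] \<and> hd X'" "R'' = R \<or> R'' = insert (u i) R" for c' R''
    using that Cons.prems(3,4) lu assms(4,5)
    by (intro Cons.IH len) (auto simp: inj_eq)
  have IH_keep: "(\<Sum>U\<in>?M c'. ?N (i + 1) X' ?R' U) = (\<Sum>U\<in>?M c'. ?N i (x # X') R (c # U))" for c'
    using cx by (intro sum.cong) auto
  have sum_Cons: "(\<Sum>U\<in>Cons b ` ?M c'. ?N i X R U) = (\<Sum>U\<in>?M c'. ?N i X R (b # U))" for b c'
    by (subst sum.reindex) (auto simp: o_def)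
  show ?case
  proof (cases s)
    case False
    have "{U. shift c (s # S) U \<and> list_all2 (\<longrightarrow>) U X} = Cons c ` ?M False"
      using False cx X by (auto simp: list_all2_Cons2 image_iff)
    moreover have "row l i (s # S) \<union> (row u i (if c then False # tl X else X) \<union> R)
        = row l (i + 1) S \<union> (row u (i + 1) (if False then False # tl X' else X') \<union> ?R')"
      using False X cx by auto
    ultimately show ?thesis
      using IH[of False ?R'] IH_keep[of False] sum_Cons[of c False] X by simp
  next
    case True
    let ?Q = "row l (i + 1) S \<union> (row u (i + 1) X' \<union> ?R')"
    have li: "l i \<notin> ?Q"
      using notin assms(3,5) by (auto dest!: row_elem simp: inj_eq)
    have ui: "u i \<notin> row l j S" "u i \<notin> row u (i + 1) X'" for j
      using notin assms(3-5) by (auto dest!: row_elem simp: inj_eq) metis+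
    have finQ: "finite ?Q" using R by simp
    have "row l i (s # S) \<union> (row u i (if c then False # tl X else X) \<union> R) = insert (l i) ?Q"
      using True X cx by auto
    then have eq: "num_tilings (row l i (s # S) \<union> (row u i (if c then False # tl X else X) \<union> R))
        = (\<Sum>d | d \<in> ?Q \<and> adjacent (l i) d. num_tilings (?Q - {d}))"
      using num_tilings_insert[OF finQ li] by simp
    \<comment> \<open>Joining \<open>l i\<close> to \<open>u (i + 1)\<close> takes the first cell of
      \<open>X'\<close> and hands the flag \<open>True\<close> to the later columns. If that cell is
      absent, there is neither such a tile nor a list \<open>U\<close> for this flag.\<close>
    have carry: "(\<Sum>d | d \<in> row u (i + 1) X' \<and> adjacent (l i) d. num_tilings (?Q - {d}))
        = (\<Sum>U\<in>?M True. ?N i X R (c # U))"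
    proof (cases "X' \<noteq> [] \<and> hd X'")
      case hd: True
      then have X': "X' = True # tl X'" by (cases X') auto
      have r: "row u (i + 1) X' = insert (u (i + 1)) (row u (i + 1 + 1) (tl X'))"
        by (subst X') simp
      have "u (i + 1) \<notin> row u (i + 1 + 1) (tl X')" "u (i + 1) \<notin> R" "u (i + 1) \<noteq> u i" "u (i + 1) \<notin> row l (i + 1) S"
        using Cons.prems(4)[of "i + 1"] assms(4,5) by (auto dest!: row_elem simp: inj_eq) metis
      then have "?Q - {u (i + 1)} = row l (i + 1) S \<union> (row u (i + 1) (if True then False # tl X' else X') \<union> ?R')"
        unfolding r by auto
      then have "num_tilings (?Q - {u (i + 1)}) = (\<Sum>U\<in>?M True. ?N (i + 1) X' ?R' U)"
        using IH[of True ?R'] hd by auto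
      moreover have "{d. d \<in> row u (i + 1) X' \<and> adjacent (l i) d} = {u (i + 1)}"
        unfolding r using lu by (auto dest!: row_elem simp: inj_eq)
      ultimately show ?thesis using IH_keep[of True] X by simp
    next
      case hd: False
      have "{d. d \<in> row u (i + 1) X' \<and> adjacent (l i) d} = {}"
        using hd lu by (cases X') (auto dest!: row_elem simp: inj_eq)
      moreover have "?M True = {}"
        using hd by (auto dest!: shift_True_hd simp: list_all2_Cons1 neq_Nil_conv)
      ultimately show ?thesis by (simp only: sum.empty)
    qed
    have Q_eq: "{d. d \<in> ?Q \<and> adjacent (l i) d}
        = (if x \<and> \<not> c then {u i} else {}) \<union> {d. d \<in> row u (i + 1) X' \<and> adjacent (l i) d}"
      using nonadj ll lu by (auto dest!: row_elem[where f = l])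
    show ?thesis
    proof (cases "x \<and> \<not> c")
      case stay: True
      have "?Q - {u i} = row l (i + 1) S \<union> (row u (i + 1) (if False then False # tl X' else X') \<union> R)"
        using stay ui notin by auto
      then have "num_tilings (?Q - {u i}) = (\<Sum>U\<in>?M False. ?N (i + 1) X' R U)"
        using IH[of False R] by simp
      also have "\<dots> = (\<Sum>U\<in>Cons True ` ?M False. ?N i X R U)"
        unfolding sum_Cons using stay X by simp
      finally have 1: "num_tilings (?Q - {u i}) = (\<Sum>U\<in>Cons True ` ?M False. ?N i X R U)" .
      have set: "{U. shift c (s # S) U \<and> list_all2 (\<longrightarrow>) U X} = Cons True ` ?M False \<union> Cons False ` ?M True"
      proof (rule set_eqI)
        fix U
        show "U \<in> {U. shift c (s # S) U \<and> list_all2 (\<longrightarrow>) U X} \<longleftrightarrow> U \<in> Cons True ` ?M False \<union> Cons False ` ?M True"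
          using stay X True by (cases U; cases "hd U") auto
      qed
      have "(\<Sum>U | shift c (s # S) U \<and> list_all2 (\<longrightarrow>) U X. ?N i X R U)
          = (\<Sum>U\<in>Cons True ` ?M False. ?N i X R U) + (\<Sum>U\<in>Cons False ` ?M True. ?N i X R U)"
        unfolding set by (rule sum.union_disjoint) (auto simp: finite_shift)
      moreover have "(\<Sum>d | d \<in> ?Q \<and> adjacent (l i) d. num_tilings (?Q - {d}))
          = num_tilings (?Q - {u i}) + (\<Sum>d | d \<in> row u (i + 1) X' \<and> adjacent (l i) d. num_tilings (?Q - {d}))"
        unfolding Q_eq using stay ui by simp
      ultimately show ?thesis
        unfolding eq using 1 carry stay by (simp add: sum_Cons)
    next
      case no_stay: False
      have "{U. shift c (s # S) U \<and> list_all2 (\<longrightarrow>) U X} = Cons c ` ?M True"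
      proof (rule set_eqI)
        fix U
        show "U \<in> {U. shift c (s # S) U \<and> list_all2 (\<longrightarrow>) U X} \<longleftrightarrow> U \<in> Cons c ` ?M True"
          using no_stay X True cx by (cases U; cases c) auto
      qed
      then show ?thesis
        unfolding eq Q_eq using no_stay carry by (simp only: if_False Un_empty_left sum_Cons)
    qed
  qed
qed

section \<open>The shape of the region\<close>

lemma adjacent_simps:
  "adjacent (Sq i j) (Sq k l) \<longleftrightarrow> k = i + 1 \<and> l = j \<or> k = i - 1 \<and> l = j \<or> k = i \<and> l = j + 1 \<or> k = i \<and> l = j - 1"
  "adjacent (Sq i j) (UpT k l) \<longleftrightarrow> k = i \<and> l = j \<or> k = i + 1 \<and> l = j \<or> k = i \<and> l = j - 1"
  "adjacent (Sq i j) (DnT k l) \<longleftrightarrow> k = i \<and> l = j \<or> k = i - 1 \<and> l = j \<or> k = i \<and> l = j + 1"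
  "adjacent (DnT i j) (Sq k l) \<longleftrightarrow> k = i \<and> l = j \<or> k = i + 1 \<and> l = j \<or> k = i \<and> l = j - 1"
  "adjacent (UpT i j) (Sq k l) \<longleftrightarrow> k = i \<and> l = j \<or> k = i - 1 \<and> l = j \<or> k = i \<and> l = j + 1"
  "adjacent (DnT i j) (UpT k l) \<longleftrightarrow> k = i \<and> l = j \<or> k = i + 1 \<and> l = j \<or> k = i \<and> l = j - 1"
  "adjacent (UpT i j) (DnT k l) \<longleftrightarrow> k = i \<and> l = j \<or> k = i - 1 \<and> l = j \<or> k = i \<and> l = j + 1"
  "\<not> adjacent (UpT i j) (UpT k l)"
  "\<not> adjacent (DnT i j) (DnT k l)"
  by (auto simp: adjacent_def doubleton_eq_iff)

lemma sum_list_pos_nat: "xs \<noteq> [] \<Longrightarrow> \<forall>x\<in>set xs. x > 0 \<Longrightarrow> sum_list xs > (0 :: nat)"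
  by (cases xs) auto

section \<open>Vertical edges of lattice paths\<close>

definition vertical_step :: "int \<times> int \<Rightarrow> int \<times> int \<Rightarrow> (int \<times> int) set" where
  "vertical_step p q = (if fst p = fst q \<and> snd p \<noteq> snd q then {(fst p, min (snd p) (snd q))} else {})"

lemma vert_edges_conv: "vert_edges ps = (\<Union>e\<in>set (zip ps (tl ps)). vertical_step (fst e) (snd e))"
proof (intro subset_antisym subsetI)
  fix e assume "e \<in> vert_edges ps"
  then obtain p q where "(p, q) \<in> set (zip ps (tl ps))" "e \<in> vertical_step p q"
    unfolding vert_edges_def vertical_step_def by auto
  then show "e \<in> (\<Union>e\<in>set (zip ps (tl ps)). vertical_step (fst e) (snd e))"
    by force
next
  fix e assume "e \<in> (\<Union>e\<in>set (zip ps (tl ps)). vertical_step (fst e) (snd e))"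
  then obtain p q where "(p, q) \<in> set (zip ps (tl ps))" "e \<in> vertical_step p q"
    by force
  then show "e \<in> vert_edges ps"
    unfolding vert_edges_def vertical_step_def
    by (intro CollectI exI[of _ p] exI[of _ q]) (auto split: if_splits)
qed

lemma vert_edges_Nil: "vert_edges [] = {}"
  and vert_edges_single: "vert_edges [p] = {}"
  and vert_edges_Cons: "vert_edges (p # q # ps) = vertical_step p q \<union> vert_edges (q # ps)"
  by (auto simp: vert_edges_conv)

lemma vert_edges_append:
  "ps \<noteq> [] \<Longrightarrow> qs \<noteq> [] \<Longrightarrow>
    vert_edges (ps @ qs) = vert_edges ps \<union> vertical_step (last ps) (hd qs) \<union> vert_edges qs"
proof (induction ps rule: induct_list012)
  case (2 p)
  then show ?case by (cases qs) (auto simp: vert_edges_Cons vert_edges_single)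
next
  case (3 p q ps)
  then show ?case by (auto simp: vert_edges_Cons)
qed simp

lemma finite_vert_edges: "finite (vert_edges ps)"
proof (induction ps rule: induct_list012)
  case (3 p q ps)
  then show ?case by (simp add: vert_edges_Cons vertical_step_def)
qed (simp_all add: vert_edges_Nil vert_edges_single)

lemma vert_edges_map_upt:
  "vert_edges (map f [0..<Suc n]) = (\<Union>t<n. vertical_step (f t) (f (Suc t)))"
proof (induction n)
  case (Suc n)
  have "vert_edges (map f [0..<Suc (Suc n)]) = vert_edges (map f [0..<Suc n] @ [f (Suc n)])"
    by simp
  also have "\<dots> = vert_edges (map f [0..<Suc n]) \<union> vertical_step (f n) (f (Suc n))"
    by (subst vert_edges_append) (auto simp: vert_edges_single)
  finally show ?case unfolding Suc by (auto simp: lessThan_Suc)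
qed (simp add: vert_edges_single)

lemma vert_edges_map_rev_upt:
  "vert_edges (map f (rev [0..<Suc n])) = (\<Union>t<n. vertical_step (f (Suc t)) (f t))"
proof (induction n)
  case (Suc n)
  have "vert_edges (map f (rev [0..<Suc (Suc n)])) = vertical_step (f (Suc n)) (f n) \<union> vert_edges (map f (rev [0..<Suc n]))"
    by (simp add: vert_edges_Cons)
  then show ?case unfolding Suc by (auto simp: lessThan_Suc)
qed (simp add: vert_edges_single)

definition zigzag :: "(nat \<Rightarrow> 'a) \<Rightarrow> (nat \<Rightarrow> 'a) \<Rightarrow> nat \<Rightarrow> 'a list" where
  "zigzag f g n = concat (map (\<lambda>m. [f m, g m]) [0..<n])"

lemma zigzag_Suc: "zigzag f g (Suc n) = zigzag f g n @ [f n, g n]"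
  by (simp add: zigzag_def)

lemma zigzag_ends:
  assumes "n > 0"
  shows "zigzag f g n \<noteq> []" "hd (zigzag f g n) = f 0" "last (zigzag f g n) = g (n - 1)"
proof -
  have "zigzag f g n \<noteq> [] \<and> hd (zigzag f g n) = f 0 \<and> last (zigzag f g n) = g (n - 1)"
    using assms
  proof (induction n rule: nat_induct_non_zero)
    case 1
    then show ?case by (simp add: zigzag_def)
  qed (simp add: zigzag_Suc)
  then show "zigzag f g n \<noteq> []" "hd (zigzag f g n) = f 0" "last (zigzag f g n) = g (n - 1)" by auto
qed

lemma vert_edges_zigzag:
  assumes "n > 0"
  shows "vert_edges (zigzag f g n)
     = (\<Union>m<n. vertical_step (f m) (g m)) \<union> (\<Union>m\<in>{m. Suc m < n}. vertical_step (g m) (f (Suc m)))"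
  using assms
proof (induction n rule: nat_induct_non_zero)
  case (Suc n)
  have "vert_edges (zigzag f g (Suc n)) = vert_edges (zigzag f g n)
      \<union> vertical_step (g (n - 1)) (f n) \<union> vertical_step (f n) (g n)"
    using Suc.hyps zigzag_ends[of n f g] unfolding zigzag_Suc
    by (subst vert_edges_append) (auto simp: vert_edges_Cons vert_edges_single)
  moreover have "{m. Suc m < Suc n} = insert (n - 1) {m. Suc m < n}"
    using Suc.hyps by auto
  ultimately show ?case
    unfolding Suc.IH using Suc.hyps by (auto simp: lessThan_Suc)
qed (simp add: vert_edges_Cons vert_edges_single zigzag_def lessThan_Suc)

section \<open>Colours of the rows and coordinates of the boundary\<close>

locale douglas_region =
  fixes A :: "int \<times> int" and a :: nat and ds :: "nat list"
  assumes a_pos: "a > 0"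
    and k_pos: "ds \<noteq> []"
    and d_pos: "\<forall>d \<in> set ds. d > 0"
    and l'_white: "\<forall>i j. i - j = lev0 A + int (sum_list ds) \<longrightarrow> \<not> black A ds (Sq i j)"
    and B_D_horizontal: "snd (vB A ds) = snd (vD A a)"
begin

abbreviation (input) n :: nat where "n \<equiv> sum_list ds"

definition drawn :: "nat \<Rightarrow> bool" where
  "drawn t \<longleftrightarrow> lev0 A + int t \<in> drawn_levels A ds"

text \<open>On the diagonal at distance \<open>t\<close> below \<open>l\<close>,
  \<open>i + j - lev0 A\<close> equals \<open>2 * j + t\<close>, so all its squares, or all its
  upper triangles, share the colour recorded here.\<close>

definition upper_black :: "nat \<Rightarrow> bool" where
  "upper_black t \<longleftrightarrow> odd (int t + int (nb_above A ds (lev0 A + int t)))"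

lemma n_pos: "n > 0"
  using sum_list_pos_nat k_pos d_pos by blast

lemma drawn_levels_bounds:
  assumes "c \<in> drawn_levels A ds"
  shows "lev0 A < c" "c < lev0 A + int n"
proof -
  obtain s where s: "c = lev0 A + int (sum_list (take s ds))" "1 \<le> s" "s < length ds"
    using assms by (auto simp: drawn_levels_def)
  have "sum_list (take s ds) > 0" "sum_list (drop s ds) > 0"
    using s d_pos k_pos by (auto intro!: sum_list_pos_nat dest: in_set_takeD in_set_dropD)
  moreover have "n = sum_list (take s ds) + sum_list (drop s ds)"
    by (metis append_take_drop_id sum_list_append)
  ultimately show "lev0 A < c" "c < lev0 A + int n" using s by auto
qed

lemma drawn_bounds: "drawn t \<Longrightarrow> 0 < t \<and> t < n"
  using drawn_levels_bounds[of "lev0 A + int t"] by (auto simp: drawn_def)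

lemma finite_drawn_levels: "finite (drawn_levels A ds)"
  by (rule finite_subset[of _ "{lev0 A<..<lev0 A + int n}"]) (simp_all add: subset_iff drawn_levels_bounds)

lemma nb_above_Suc: "nb_above A ds (lev0 A + int (Suc t)) = nb_above A ds (lev0 A + int t) + of_bool (drawn t)"
proof -
  let ?D = "{l \<in> drawn_levels A ds. l < lev0 A + int t}"
  have "l < lev0 A + int (Suc t) \<longleftrightarrow> l = lev0 A + int t \<or> l < lev0 A + int t" for l
    by auto
  then have "{l \<in> drawn_levels A ds. l < lev0 A + int (Suc t)} = (if drawn t then insert (lev0 A + int t) ?D else ?D)"
    by (auto simp only: drawn_def split: if_splits)
  then show ?thesis using finite_drawn_levels by (simp add: nb_above_def)
qed

text \<open>The colour changes from the lower cells of a diagonal to the upper cells of the next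
  one, and along a drawn-in diagonal once more between its two triangles.\<close>

lemma upper_black_Suc: "upper_black (Suc t) \<longleftrightarrow> (upper_black t \<longleftrightarrow> drawn t)"
  by (auto simp: upper_black_def nb_above_Suc simp del: of_nat_Suc)

lemma not_upper_black_0: "\<not> upper_black 0"
proof -
  have "{l \<in> drawn_levels A ds. l < lev0 A} = {}"
    by (auto dest: drawn_levels_bounds(1))
  then have "nb_above A ds (lev0 A) = 0"
    by (simp only: nb_above_def card.empty)
  then show ?thesis by (simp add: upper_black_def)
qed

lemma not_drawn_0: "\<not> drawn 0" and not_drawn_n: "\<not> drawn n"
  using drawn_bounds by blast+

lemma not_upper_black_n: "\<not> upper_black n"
  using l'_white[rule_format, of "lev0 A + int n" 0] by (simp add: upper_black_def add.commute)

lemma black_cell_top: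
  assumes "i - j = lev0 A + int t"
  shows "black A ds (cell_top A ds i j) \<longleftrightarrow> upper_black t"
proof -
  have "i + j - lev0 A + x = 2 * j + (int t + x)" for x using assms by simp
  then have "odd (i + j - lev0 A + x) \<longleftrightarrow> odd (2 * j + (int t + x))" for x by (simp only:)
  then have "odd (i + j - lev0 A + x) \<longleftrightarrow> odd (int t + x)" for x by (simp only: even_add even_mult_iff even_numeral simp_thms)
  then show ?thesis
    by (cases "lev0 A + int t \<in> drawn_levels A ds")
      (simp_all only: cell_top_def upper_black_def black.simps assms if_True if_False)
qed

lemma black_cell_right: "i - j = lev0 A + int t \<Longrightarrow> black A ds (cell_right A ds i j) \<longleftrightarrow> \<not> upper_black (Suc t)"
  using black_cell_top[of i j t] by (auto simp: cell_top_def cell_right_def upper_black_Suc drawn_def)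

primrec east :: "nat \<Rightarrow> nat" where
  "east 0 = 0"
| "east (Suc t) = east t + of_bool (upper_black (Suc t))"

primrec south :: "nat \<Rightarrow> nat" where
  "south 0 = 0"
| "south (Suc t) = south t + of_bool (\<not> upper_black (Suc t))"

lemma east_plus_south: "east t + south t = t"
  by (induction t) auto

text \<open>The \<open>t\<close>-th point lies on the diagonal at distance \<open>t\<close>. A south
  step from it inspects a lower cell of this diagonal, an east step an upper cell of the next one.
  These have opposite colours, so the step goes east exactly if
  \<open>upper_black (Suc t)\<close>.\<close>

lemma ne_point_eq: "ne_point A ds t = (fst A + int (east t), snd A - int (south t))"
proof (induction t)
  case (Suc t)
  have 1: "(fst A + int (east t) - 1) - (snd A - int (south t) - 1) = lev0 A + int t"
    and 2: "(fst A + int (east t)) - (snd A - int (south t) - 1) = lev0 A + int (Suc t)"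
    using east_plus_south[of t] by (auto simp: lev0_def)
  show ?case using Suc black_cell_right[OF 1] black_cell_top[OF 2] by simp
qed simp

text \<open>Abscissas of the southwestern and the northeastern boundary point on the diagonal at
  distance \<open>t\<close>. The reflection exchanges the two directions, so \<open>lo\<close>
  advances with the south steps and \<open>hi\<close> with the east steps.\<close>

definition lo :: "nat \<Rightarrow> int" where "lo t = fst A - int a + int (south t)"
definition hi :: "nat \<Rightarrow> int" where "hi t = fst A + int (east t)"

lemma sw_point_eq: "sw_point A a ds t = (lo t, snd A - int a - int (east t))"
  by (simp add: sw_point_def reflect_def ne_point_eq lo_def)

text \<open>\<open>B\<close> lies \<open>south n\<close> below \<open>A\<close>, and
  \<open>D\<close> lies \<open>a\<close> below \<open>A\<close>. Thus there are as many south steps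
  as white cells in the top row.\<close>

lemma south_n: "south n = a"
  using B_D_horizontal by (simp add: vB_def vD_def ne_point_eq)

lemma south_mono: "mono south"
  by (rule mono_iff_le_Suc[THEN iffD2]) simp
lemma east_mono: "mono east"
  by (rule mono_iff_le_Suc[THEN iffD2]) simp

text \<open>The difference is \<open>a - south t + east t\<close>. There are at most
  \<open>a\<close> south steps, and the first step goes east because \<open>l\<close> crosses white
  squares and is not drawn in.\<close>

lemma lo_less_hi: "t \<le> n \<Longrightarrow> lo t < hi t"
proof (cases t)
  case 0
  then show ?thesis using a_pos by (simp add: lo_def hi_def)
next
  case (Suc s)
  assume "t \<le> n"
  then have "south t \<le> a" using south_mono south_n by (metis monoD)
  moreover have "east (Suc 0) \<le> east t"
    using monoD[OF east_mono, of "Suc 0" t] Suc by (simp del: east.simps)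
  ultimately show ?thesis
    by (simp add: lo_def hi_def upper_black_Suc not_upper_black_0 not_drawn_0)
qed

lemma width_eq: "width A a ds = east n" "int (width A a ds) = hi n - lo n"
  using south_n by (simp_all add: width_def vB_def vC_def sw_point_eq ne_point_eq lo_def hi_def)

lemma lo_Suc: "lo (Suc t) = (if upper_black (Suc t) then lo t else lo t + 1)"
  and hi_Suc: "hi (Suc t) = (if upper_black (Suc t) then hi t + 1 else hi t)"
  by (simp_all add: lo_def hi_def)

section \<open>The enclosed squares, determined by ray crossings\<close>

definition inside :: "int \<Rightarrow> int \<Rightarrow> bool" where
  "inside i j \<longleftrightarrow> (\<exists>t\<le>n. i - j = lev0 A + int t \<and> lo t \<le> i \<and> i < hi t)"

lemma vert_edges_boundary:
  "vert_edges (boundary A a ds) =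
     (\<lambda>m. (lo 0 + int m, snd A - int a + int m)) ` {..<a}
   \<union> (\<lambda>t. (hi t, snd A - int (south t) - 1)) ` {t. t < n \<and> \<not> upper_black (Suc t)}
   \<union> (\<lambda>m. (hi n - int m, snd A - int a - int m - 1)) ` {..<east n}
   \<union> (\<lambda>t. (lo t, snd A - int a - int (east t) - 1)) ` {t. t < n \<and> upper_black (Suc t)}"
proof -
  have w_pos: "east n > 0" using lo_less_hi[of n] south_n by (simp add: lo_def hi_def)
  let ?f = "\<lambda>m. (lo 0 + int m, snd A - int a + int m)" and ?g = "\<lambda>m. (lo 0 + int m, snd A - int a + int m + 1)"
  let ?f' = "\<lambda>m. (hi n - int m, snd A - int a - int m - 1)" and ?g' = "\<lambda>m. (hi n - int m - 1, snd A - int a - int m - 1)"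
  let ?top = "zigzag ?f ?g a" and ?ne = "map (ne_point A ds) [0..<Suc n]"
    and ?bot = "zigzag ?f' ?g' (east n)" and ?sw = "map (sw_point A a ds) (rev [0..<n])"
  have bd: "boundary A a ds = ?top @ ?ne @ ?bot @ ?sw"
    by (simp add: boundary_def Let_def width_eq zigzag_def vD_def vB_def ne_point_eq lo_def hi_def south_n del: upt_Suc)
  have top: "vert_edges ?top = ?f ` {..<a}"
    unfolding vert_edges_zigzag[OF a_pos] by (auto simp: vertical_step_def)
  have ne: "vert_edges ?ne = (\<lambda>t. (hi t, snd A - int (south t) - 1)) ` {t. t < n \<and> \<not> upper_black (Suc t)}"
    unfolding vert_edges_map_upt by (auto simp: vertical_step_def ne_point_eq hi_def simp del: ne_point.simps split: if_splits)
  \<comment> \<open>The zigzag list starts one step below \<open>B\<close>, so its first vertical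
    edge comes from the joint with the preceding list.\<close>
  have bot: "{(hi n, snd A - int a - 1)} \<union> vert_edges ?bot = ?f' ` {..<east n}"
  proof -
    have "{..<east n} = insert 0 (Suc ` {m. Suc m < east n})"
      using w_pos by (auto simp: image_iff gr0_conv_Suc less_Suc_eq_0_disj)
    moreover have "vert_edges ?bot = (\<Union>m\<in>{m. Suc m < east n}. {?f' (Suc m)})"
      unfolding vert_edges_zigzag[OF w_pos] by (auto simp: vertical_step_def)
    ultimately show ?thesis
      by (simp only: image_insert image_image UNION_singleton_eq_range) simp
  qed
  have ne_bot: "vertical_step (last ?ne) (hd ?bot) = {(hi n, snd A - int a - 1)}"
    using zigzag_ends[OF w_pos, of ?f' ?g'] by (simp add: vertical_step_def ne_point_eq hi_def south_n)
  have top_ne: "vertical_step (last ?top) (hd ?ne) = {}"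
    using zigzag_ends[OF a_pos, of ?f ?g] a_pos
    by (simp add: vertical_step_def lo_def hd_map upt_conv_Cons del: upt_Suc)
  have "last ?bot = sw_point A a ds n"
    using zigzag_ends[OF w_pos, of ?f' ?g'] w_pos by (simp add: sw_point_eq lo_def hi_def south_n)
  moreover have sw_ne: "?sw \<noteq> []"
  proof -
    have "length ?sw > 0" using n_pos by (simp only: length_map length_rev length_upt diff_zero)
    then show ?thesis by (rule length_greater_0_conv[THEN iffD1])
  qed
  \<comment> \<open>The last list omits the point with index \<open>n\<close>; this is
    \<open>C\<close>, the end of the zigzag from \<open>B\<close>, and prepending it gives the full
    reversed boundary.\<close>
  ultimately have "vertical_step (last ?bot) (hd ?sw) \<union> vert_edges ?sw
      = vert_edges (map (sw_point A a ds) (rev [0..<Suc n]))"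
    using vert_edges_append[of "[sw_point A a ds n]" ?sw] by (simp add: vert_edges_single)
  also have "\<dots> = (\<lambda>t. (lo t, snd A - int a - int (east t) - 1)) ` {t. t < n \<and> upper_black (Suc t)}"
    unfolding vert_edges_map_rev_upt by (auto simp: vertical_step_def sw_point_eq lo_def split: if_splits)
  finally have sw: "vertical_step (last ?bot) (hd ?sw) \<union> vert_edges ?sw
      = (\<lambda>t. (lo t, snd A - int a - int (east t) - 1)) ` {t. t < n \<and> upper_black (Suc t)}" .
  have "vert_edges (boundary A a ds) = vert_edges ?top \<union> vertical_step (last ?top) (hd ?ne) \<union>
      (vert_edges ?ne \<union> vertical_step (last ?ne) (hd ?bot) \<union>
      (vert_edges ?bot \<union> vertical_step (last ?bot) (hd ?sw) \<union> vert_edges ?sw))"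
  proof -
    have "?top \<noteq> []" "?ne \<noteq> []" "?bot \<noteq> []"
      using zigzag_ends(1) a_pos w_pos by (auto simp: zigzag_ends(1))
    then show ?thesis
      unfolding bd using sw_ne
      by (simp only: vert_edges_append append_is_Nil_conv hd_append2 simp_thms)
  qed
  also have "\<dots> = vert_edges ?top \<union> vert_edges ?ne \<union> ({(hi n, snd A - int a - 1)} \<union> vert_edges ?bot)
      \<union> (vertical_step (last ?bot) (hd ?sw) \<union> vert_edges ?sw)"
    unfolding top_ne ne_bot by blast
  finally show ?thesis unfolding top ne bot sw .
qed

text \<open>The two squares lie on consecutive diagonals. Next to a zigzag only one of these
  diagonals meets the region. Elsewhere the column intervals of the two diagonals, compared after a
  shift by one, differ in one place: at the left end for an east step, at the right end for a south
  step.\<close>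

lemma mem_vert_edges_boundary:
  "(i + 1, j) \<in> vert_edges (boundary A a ds) \<longleftrightarrow> (inside i j \<noteq> inside (i + 1) j)"
proof -
  let ?g = "i - j - lev0 A"
  have es: "int (east t) + int (south t) = int t" for t
    using east_plus_south[of t] by linarith
  have lh: "t \<le> n \<Longrightarrow> lo t < hi t" for t by (rule lo_less_hi)
  have ends: "lo 0 = fst A - int a" "hi 0 = fst A" "lo n = fst A" "hi n = fst A + int (east n)"
    by (simp_all add: lo_def hi_def south_n)
  have in_i: "inside i j \<longleftrightarrow> 0 \<le> i - j - lev0 A \<and> i - j - lev0 A \<le> int n
      \<and> lo (nat (i - j - lev0 A)) \<le> i \<and> i < hi (nat (i - j - lev0 A))" for i
    unfolding inside_def by (intro iffI) (auto intro!: exI[of _ "nat (i - j - lev0 A)"])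
  have in_i1: "inside (i + 1) j \<longleftrightarrow> -1 \<le> ?g \<and> ?g < int n \<and> lo (nat (?g + 1)) \<le> i + 1 \<and> i + 1 < hi (nat (?g + 1))"
  proof -
    have eq: "i + 1 - j - lev0 A = ?g + 1" by simp
    show ?thesis unfolding in_i eq by auto
  qed
  have top: "(i + 1, j) \<in> (\<lambda>m. (lo 0 + int m, snd A - int a + int m)) ` {..<a}
      \<longleftrightarrow> ?g = -1 \<and> lo 0 \<le> i + 1 \<and> i + 1 < hi 0"
    unfolding image_iff ends by (auto simp: lev0_def intro!: bexI[of _ "nat (i + 1 - fst A + int a)"])
  have bot: "(i + 1, j) \<in> (\<lambda>m. (hi n - int m, snd A - int a - int m - 1)) ` {..<east n}
      \<longleftrightarrow> ?g = int n \<and> lo n \<le> i \<and> i < hi n"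
    unfolding image_iff ends using es[of n] south_n
    by (auto simp: lev0_def intro!: bexI[of _ "nat (fst A + int (east n) - i - 1)"])
  have ne: "(i + 1, j) \<in> (\<lambda>t. (hi t, snd A - int (south t) - 1)) ` {t. t < n \<and> \<not> upper_black (Suc t)}
      \<longleftrightarrow> 0 \<le> ?g \<and> ?g < int n \<and> \<not> upper_black (Suc (nat ?g)) \<and> i + 1 = hi (nat ?g)"
  proof
    assume "0 \<le> ?g \<and> ?g < int n \<and> \<not> upper_black (Suc (nat ?g)) \<and> i + 1 = hi (nat ?g)"
    then show "(i + 1, j) \<in> (\<lambda>t. (hi t, snd A - int (south t) - 1)) ` {t. t < n \<and> \<not> upper_black (Suc t)}"
      using es[of "nat ?g"] by (intro image_eqI[of _ _ "nat ?g"]) (auto simp: hi_def lev0_def)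
  next
    assume "(i + 1, j) \<in> (\<lambda>t. (hi t, snd A - int (south t) - 1)) ` {t. t < n \<and> \<not> upper_black (Suc t)}"
    then obtain t where t: "t < n" "\<not> upper_black (Suc t)" "i + 1 = hi t" "j = snd A - int (south t) - 1" by auto
    then have "?g = int t" using es[of t] by (simp add: hi_def lev0_def)
    then show "0 \<le> ?g \<and> ?g < int n \<and> \<not> upper_black (Suc (nat ?g)) \<and> i + 1 = hi (nat ?g)"
      using t by simp
  qed
  have sw: "(i + 1, j) \<in> (\<lambda>t. (lo t, snd A - int a - int (east t) - 1)) ` {t. t < n \<and> upper_black (Suc t)}
      \<longleftrightarrow> 0 \<le> ?g \<and> ?g < int n \<and> upper_black (Suc (nat ?g)) \<and> i + 1 = lo (nat ?g)"
  proof
    assume "0 \<le> ?g \<and> ?g < int n \<and> upper_black (Suc (nat ?g)) \<and> i + 1 = lo (nat ?g)"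
    then show "(i + 1, j) \<in> (\<lambda>t. (lo t, snd A - int a - int (east t) - 1)) ` {t. t < n \<and> upper_black (Suc t)}"
      using es[of "nat ?g"] by (intro image_eqI[of _ _ "nat ?g"]) (auto simp: lo_def lev0_def)
  next
    assume "(i + 1, j) \<in> (\<lambda>t. (lo t, snd A - int a - int (east t) - 1)) ` {t. t < n \<and> upper_black (Suc t)}"
    then obtain t where t: "t < n" "upper_black (Suc t)" "i + 1 = lo t" "j = snd A - int a - int (east t) - 1" by auto
    then have "?g = int t" using es[of t] by (simp add: lo_def lev0_def)
    then show "0 \<le> ?g \<and> ?g < int n \<and> upper_black (Suc (nat ?g)) \<and> i + 1 = lo (nat ?g)"
      using t by simp
  qed
  consider "?g < -1" | "?g = -1" | t where "?g = int t" "t < n" | "?g = int n" | "?g > int n"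
  proof -
    have "?g < -1 \<or> ?g = -1 \<or> ?g = int (nat ?g) \<and> nat ?g < n \<or> ?g = int n \<or> ?g > int n" by linarith
    then show thesis using that by blast
  qed
  then show ?thesis
  proof cases
    case (3 t)
    then have [simp]: "nat (int t + 1) = Suc t" by auto
    show ?thesis
      unfolding vert_edges_boundary Un_iff top bot ne sw in_i1 in_i[of i]
      using 3 lh[of t] lh[of "Suc t"] by (auto simp: lo_Suc hi_Suc)
  qed (unfold vert_edges_boundary Un_iff top bot ne sw in_i1 in_i[of i], auto)
qed

text \<open>Moving one square to the west adds the edge at \<open>i + 1\<close>, which changes the
  parity exactly if membership changes. The induction starts beyond \<open>l'\<close>, where no
  square is inside and no edge is left to cross.\<close>

lemma encloses_iff: "encloses (boundary A a ds) i j \<longleftrightarrow> inside i j"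
proof (induction "nat (j + lev0 A + int n + 1 - i)" arbitrary: i)
  case 0
  then have "\<not> inside i' j" if "i' \<ge> i" for i'
    using that by (auto simp: inside_def)
  then have "{x. x > i \<and> (x, j) \<in> vert_edges (boundary A a ds)} = {}" "\<not> inside i j"
    using mem_vert_edges_boundary[of "x - 1" j for x] by auto
  then show ?case by (simp only: encloses_def card.empty) simp
next
  case (Suc k)
  let ?V = "\<lambda>i. {x. x > i \<and> (x, j) \<in> vert_edges (boundary A a ds)}"
  have IH: "odd (card (?V (i + 1))) \<longleftrightarrow> inside (i + 1) j"
    using Suc.hyps(1)[of "i + 1"] Suc.hyps(2) by (simp add: encloses_def)
  have fin: "finite (?V (i + 1))"
    by (rule finite_subset[of _ "fst ` vert_edges (boundary A a ds)"]) (force simp: finite_vert_edges)+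
  have "x > i \<longleftrightarrow> x = i + 1 \<or> x > i + 1" for x by auto
  then have "?V i = (if (i + 1, j) \<in> vert_edges (boundary A a ds) then insert (i + 1) (?V (i + 1)) else ?V (i + 1))"
    by auto
  then have "card (?V i) = card (?V (i + 1)) + of_bool (inside i j \<noteq> inside (i + 1) j)"
    using fin mem_vert_edges_boundary[of i j] by auto
  then show ?case using IH by (auto simp: encloses_def)
qed

section \<open>Counting tilings and regular cells\<close>

text \<open>The cells of a diagonal indexed by column; if it is not drawn in, \<open>upper\<close>
  and \<open>lower\<close> give the same square.\<close>

definition upper :: "nat \<Rightarrow> int \<Rightarrow> cell" where
  "upper t i = cell_top A ds i (i - lev0 A - int t)"

definition lower :: "nat \<Rightarrow> int \<Rightarrow> cell" where
  "lower t i = cell_right A ds i (i - lev0 A - int t)"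

lemma upper_eq: "upper t i = (if drawn t then UpT else Sq) i (i - lev0 A - int t)"
  and lower_eq: "lower t i = (if drawn t then DnT else Sq) i (i - lev0 A - int t)"
  by (simp_all add: upper_def lower_def cell_top_def cell_right_def drawn_def)

lemma upper_inject [simp]: "upper s i = upper t j \<longleftrightarrow> s = t \<and> i = j"
  and lower_inject [simp]: "lower s i = lower t j \<longleftrightarrow> s = t \<and> i = j"
  by (auto simp: upper_eq lower_eq)

lemma upper_eq_lower_iff: "upper s i = lower t j \<longleftrightarrow> s = t \<and> i = j \<and> \<not> drawn t"
  by (auto simp: upper_eq lower_eq)

lemma lower_eq_upper_iff: "lower s i = upper t j \<longleftrightarrow> s = t \<and> i = j \<and> \<not> drawn t"
  by (auto simp: upper_eq lower_eq)

lemma adjacent_lower_upper_Suc: "adjacent (lower t j) (upper (Suc t) k) \<longleftrightarrow> k = j \<or> k = j + 1"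
  by (auto simp: upper_eq lower_eq adjacent_simps)

lemma adjacent_upper_lower: "drawn t \<Longrightarrow> adjacent (upper t j) (lower t k) \<longleftrightarrow> j = k"
  by (auto simp: upper_eq lower_eq adjacent_simps)

lemma not_adjacent_same_row:
  "\<not> adjacent (upper t j) (upper t k)" "\<not> adjacent (lower t j) (lower t k)"
  by (auto simp: upper_eq lower_eq adjacent_simps)

lemma not_adjacent_lower_lower: "s < t \<Longrightarrow> drawn t \<Longrightarrow> \<not> adjacent (lower s j) (lower t k)"
  by (auto simp: lower_eq adjacent_simps)

lemma not_adjacent_far:
  assumes "Suc (Suc s) \<le> t"
  shows "\<not> adjacent (lower s j) (lower t k)" "\<not> adjacent (lower s j) (upper t k)"
  using assms by (auto simp: upper_eq lower_eq adjacent_simps)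

lemma not_adjacent_drawn_upper:
  assumes "s < t" "drawn s"
  shows "\<not> adjacent (upper s j) (lower t k)" "\<not> adjacent (upper s j) (upper t k)"
  using assms by (auto simp: upper_eq lower_eq adjacent_simps)

definition row_length :: "nat \<Rightarrow> nat" where
  "row_length t = nat (hi t - lo t)"

lemma int_row_length: "t \<le> n \<Longrightarrow> int (row_length t) = hi t - lo t"
  using lo_less_hi[of t] by (simp add: row_length_def)

lemma row_length_Suc:
  assumes "Suc t \<le> n"
  shows "row_length (Suc t) = (if upper_black (Suc t) then Suc (row_length t) else row_length t - 1)"
  using lo_less_hi[of t] lo_less_hi[of "Suc t"] assms by (auto simp: row_length_def lo_Suc hi_Suc)

definition full_row :: "(int \<Rightarrow> cell) \<Rightarrow> nat \<Rightarrow> cell set" where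
  "full_row f t = row f (lo t) (replicate (row_length t) True)"

lemma full_row_eq: "t \<le> n \<Longrightarrow> full_row f t = f ` {lo t..<hi t}"
  by (simp add: full_row_def row_replicate_True int_row_length)

definition lower_part :: "nat \<Rightarrow> cell set" where
  "lower_part t = (if drawn t then full_row (lower t) t else {})"

definition below :: "nat \<Rightarrow> cell set" where
  "below t = (\<Union>s\<in>{t..n}. full_row (upper s) s \<union> lower_part s)"

lemma below_Suc: "t \<le> n \<Longrightarrow> below t = full_row (upper t) t \<union> (lower_part t \<union> below (Suc t))"
  by (simp add: below_def Icc_eq_insert_lb_nat Un_assoc)

lemma finite_below: "finite (below t)"
  by (simp add: below_def full_row_def lower_part_def)

lemma full_row_elem: "d \<in> full_row f t \<Longrightarrow> \<exists>k. d = f k"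
  unfolding full_row_def using row_elem by blast

lemma lower_part_elem:
  assumes "d \<in> lower_part t"
  obtains k where "drawn t" "d = lower t k"
  using assms full_row_elem[of d "lower t" t] by (cases "drawn t") (auto simp: lower_part_def)

lemma below_elem:
  assumes "d \<in> below t"
  obtains s k where "s \<ge> t" "d = upper s k" | s k where "s \<ge> t" "drawn s" "d = lower s k"
proof -
  obtain s where "s \<ge> t" "d \<in> full_row (upper s) s \<or> d \<in> lower_part s"
    using assms by (auto simp: below_def)
  then show thesis
    using that by (blast dest: full_row_elem elim: lower_part_elem)
qed

lemma douglas_eq: "douglas A a ds = below 0"
proof -
  have "c \<in> douglas A a ds \<longleftrightarrow> (\<exists>t\<le>n. \<exists>i. lo t \<le> i \<and> i < hi t \<and> (c = upper t i \<or> drawn t \<and> c = lower t i))" for c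
  proof
    assume "c \<in> douglas A a ds"
    then obtain i j where c: "c = Sq i j \<and> i - j \<notin> drawn_levels A ds \<or> c = UpT i j \<and> i - j \<in> drawn_levels A ds
        \<or> c = DnT i j \<and> i - j \<in> drawn_levels A ds" and ins: "inside i j"
      unfolding douglas_def encloses_iff by blast
    obtain t where t: "t \<le> n" "i - j = lev0 A + int t" "lo t \<le> i" "i < hi t"
      using ins unfolding inside_def by blast
    have "j = i - lev0 A - int t" using t by simp
    then have "c = upper t i \<or> drawn t \<and> c = lower t i"
      using c t(2) by (auto simp: upper_eq lower_eq drawn_def)
    then show "\<exists>t\<le>n. \<exists>i. lo t \<le> i \<and> i < hi t \<and> (c = upper t i \<or> drawn t \<and> c = lower t i)"
      using t by blast
  next
    assume "\<exists>t\<le>n. \<exists>i. lo t \<le> i \<and> i < hi t \<and> (c = upper t i \<or> drawn t \<and> c = lower t i)"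
    then obtain t i where t: "t \<le> n" "lo t \<le> i" "i < hi t" and c: "c = upper t i \<or> drawn t \<and> c = lower t i" by blast
    have "inside i (i - lev0 A - int t)" using t by (auto simp: inside_def)
    moreover have "i - (i - lev0 A - int t) = lev0 A + int t" by simp
    ultimately show "c \<in> douglas A a ds"
      using c unfolding douglas_def encloses_iff
      by (cases "drawn t") (auto simp: upper_eq lower_eq drawn_def)
  qed
  moreover have "c \<in> below 0 \<longleftrightarrow> (\<exists>t\<le>n. \<exists>i. lo t \<le> i \<and> i < hi t \<and> (c = upper t i \<or> drawn t \<and> c = lower t i))" for c
  proof -
    have "c \<in> full_row (upper t) t \<union> lower_part t
        \<longleftrightarrow> (\<exists>i. lo t \<le> i \<and> i < hi t \<and> (c = upper t i \<or> drawn t \<and> c = lower t i))" if "t \<le> n" for t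
      using that by (cases "drawn t") (simp_all add: lower_part_def full_row_eq image_iff Bex_def, blast+)
    then show ?thesis unfolding below_def by fastforce
  qed
  ultimately show ?thesis by blast
qed

text \<open>
  White cells matched downwards are the particles of a state. A black row of unit squares acts like a
  row of black up-pointing triangles followed by a row of black down-pointing ones, with virtual white
  cells in between, so that the state of a row with black upper cells consists of the cells matched
  upwards.
\<close>

definition matched_up :: "nat \<Rightarrow> bool list \<Rightarrow> bool list" where
  "matched_up t Z = (if upper_black t then Z else map Not Z)"

definition matched_down :: "nat \<Rightarrow> bool list \<Rightarrow> bool list" where
  "matched_down t Z = (if upper_black (Suc t) then Z else map Not Z)"

text \<open>What is left to tile on the diagonals from \<open>t\<close> on once the upper cells in
  \<open>matched_up t Z\<close> are covered from above.\<close>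

definition remaining :: "nat \<Rightarrow> bool list \<Rightarrow> cell set" where
  "remaining t Z = row (upper t) (lo t) (map Not (matched_up t Z)) \<union> (lower_part t \<union> below (Suc t))"

definition steps :: "nat \<Rightarrow> bool list" where
  "steps t = map (\<lambda>s. upper_black (Suc s)) [t..<n]"

lemma steps_Suc: "t < n \<Longrightarrow> steps t = upper_black (Suc t) # steps (Suc t)"
  by (simp add: steps_def upt_conv_Cons)

text \<open>Along a drawn-in diagonal the tiles joining its triangles are forced. Otherwise a square
  not matched up has to be matched down, which accounts for the complement.\<close>

lemma num_tilings_remaining_lower:
  assumes "length Z = row_length t"
  shows "num_tilings (remaining t Z) = num_tilings (row (lower t) (lo t) (matched_down t Z) \<union> below (Suc t))"
proof (cases "drawn t")
  case True
  have eq: "matched_down t Z = matched_up t Z" "length (matched_up t Z) = row_length t"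
    using True assms by (simp_all add: matched_down_def matched_up_def upper_black_Suc)
  have "num_tilings (row (upper t) (lo t) (map Not (matched_up t Z)) \<union>
      (row (lower t) (lo t) (replicate (length (matched_up t Z)) True) \<union> below (Suc t)))
    = num_tilings (row (lower t) (lo t) (matched_up t Z) \<union> below (Suc t))"
  proof (rule num_tilings_matched_rows)
    show "upper t j \<notin> below (Suc t) \<and> lower t j \<notin> below (Suc t) \<and> (\<forall>d\<in>below (Suc t). \<not> adjacent (upper t j) d)" for j
      using True by (auto elim!: below_elem simp: upper_eq_lower_iff lower_eq_upper_iff not_adjacent_drawn_upper)
  qed (use True in \<open>simp_all add: not_adjacent_same_row adjacent_upper_lower inj_def upper_eq_lower_iff finite_below\<close>)
  then show ?thesis
    using True unfolding remaining_def lower_part_def full_row_def eq by simp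
next
  case False
  have "upper t = lower t"
    using False by (auto simp: upper_eq lower_eq)
  moreover have "map Not (matched_up t Z) = matched_down t Z"
    using False by (auto simp: matched_down_def matched_up_def upper_black_Suc comp_def)
  ultimately show ?thesis
    using False by (simp add: remaining_def lower_part_def)
qed

lemma num_tilings_gap_region:
  assumes "length X = length S"
  shows "num_tilings (row (lower t) i S \<union> (row (upper (Suc t)) i X \<union> (lower_part (Suc t) \<union> below (Suc (Suc t)))))
    = (\<Sum>U | shift False S U \<and> list_all2 (\<longrightarrow>) U X.
        num_tilings (row (upper (Suc t)) i (map2 (\<lambda>x v. x \<and> \<not> v) X U) \<union> (lower_part (Suc t) \<union> below (Suc (Suc t)))))"
proof -
  let ?R = "lower_part (Suc t) \<union> below (Suc (Suc t))"
  have "lower t j \<notin> ?R \<and> upper (Suc t) j \<notin> ?R \<and> (\<forall>d\<in>?R. \<not> adjacent (lower t j) d)" for j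
    by (auto elim!: below_elem lower_part_elem
        simp: upper_eq_lower_iff lower_eq_upper_iff not_adjacent_far not_adjacent_lower_lower)
  then show ?thesis
    using num_tilings_gap[of "lower t" "upper (Suc t)" X S False ?R i] assms
    by (simp add: not_adjacent_same_row adjacent_lower_upper_Suc inj_def finite_below lower_part_def full_row_def
        lower_eq_upper_iff)
qed

lemma map2_replicate_True: "length U = k \<Longrightarrow> map2 (\<lambda>x v. x \<and> \<not> v) (replicate k True) U = map Not U"
  by (induction U arbitrary: k) auto

lemma list_all2_replicate_True: "list_all2 (\<longrightarrow>) U (replicate k True) \<longleftrightarrow> length U = k"
  by (auto simp: list_all2_conv_all_nth)

text \<open>Induction from \<open>l'\<close> upwards: crossing the gap between two consecutive
  diagonals is one move of \<open>walks\<close>, and the colour of the next row decides whether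
  elements or non-elements move.\<close>

lemma num_tilings_remaining:
  assumes "t \<le> n" "length Z = row_length t"
  shows "num_tilings (remaining t Z) = walks (steps t) Z"
  using assms
proof (induction t arbitrary: Z rule: inc_induct)
  case base
  \<comment> \<open>On \<open>l'\<close> the marked white squares would have to be matched
    downwards, where nothing is left, so only a state without elements counts.\<close>
  have "remaining n Z = row (upper n) (lo n) Z"
    using not_upper_black_n not_drawn_n by (simp add: remaining_def matched_up_def lower_part_def below_def comp_def)
  then show ?case
    using not_adjacent_same_row by (simp add: num_tilings_row_independent steps_def)
next
  case (step t)
  let ?S = "matched_down t Z" and ?R = "lower_part (Suc t) \<union> below (Suc (Suc t))"
  have len: "length ?S = row_length t" using step.prems by (simp add: matched_down_def)
  have eq: "num_tilings (remaining t Z)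
      = num_tilings (row (lower t) (lo t) ?S \<union> (full_row (upper (Suc t)) (Suc t) \<union> ?R))"
    using step.prems step.hyps by (simp add: num_tilings_remaining_lower below_Suc[of "Suc t"])
  show ?case
  proof (cases "upper_black (Suc t)")
    case True
    \<comment> \<open>East step: the next row starts in the same column and is one cell longer, so
      \<open>Z\<close> gets one more position at the end. As all cells of the row are present,
      \<open>U\<close> is restricted by its length only.\<close>
    let ?X = "replicate (row_length (Suc t)) True"
    have rl: "row_length (Suc t) = Suc (row_length t)"
      using True step.hyps by (simp add: row_length_Suc)
    have set: "{U. shift False (Z @ [False]) U \<and> list_all2 (\<longrightarrow>) U ?X} = {U. shift False (Z @ [False]) U}"
      unfolding list_all2_replicate_True using rl step.prems by (auto dest: shift_length)
    have "num_tilings (remaining t Z)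
        = num_tilings (row (lower t) (lo t) (Z @ [False]) \<union> (row (upper (Suc t)) (lo t) ?X \<union> ?R))"
      unfolding eq using True by (simp add: full_row_def row_snoc_False matched_down_def lo_Suc)
    also have "\<dots> = (\<Sum>U | shift False (Z @ [False]) U \<and> list_all2 (\<longrightarrow>) U ?X.
        num_tilings (row (upper (Suc t)) (lo t) (map2 (\<lambda>x v. x \<and> \<not> v) ?X U) \<union> ?R))"
      using step.prems rl by (intro num_tilings_gap_region) simp
    also have "\<dots> = (\<Sum>U | shift False (Z @ [False]) U. walks (steps (Suc t)) U)"
      unfolding set
    proof (rule sum.cong[OF refl])
      fix U assume "U \<in> {U. shift False (Z @ [False]) U}"
      then have l: "length U = row_length (Suc t)"
        using rl step.prems by (auto dest: shift_length)
      then show "num_tilings (row (upper (Suc t)) (lo t) (map2 (\<lambda>x v. x \<and> \<not> v) ?X U) \<union> ?R) = walks (steps (Suc t)) U"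
        using step.IH[OF l] True by (simp add: map2_replicate_True remaining_def matched_up_def lo_Suc)
    qed
    also have "\<dots> = walks (steps t) Z"
      using True step.hyps by (simp add: steps_Suc)
    finally show ?thesis .
  next
    case False
    \<comment> \<open>South step: the next row starts one column later. A missing cell in front of
      it keeps the window aligned and becomes the leading \<open>False\<close> of the south
      move.\<close>
    let ?X = "False # replicate (row_length (Suc t)) True"
    have rl: "row_length t = Suc (row_length (Suc t))"
      using False step.hyps lo_less_hi[of t] by (simp add: row_length_Suc) (simp add: row_length_def)
    have set: "{U. shift False (map Not Z) U \<and> list_all2 (\<longrightarrow>) U ?X}
        = (\<lambda>W. False # map Not W) ` {W. shift False (map Not Z) (False # map Not W)}" (is "?L = ?F ` ?W")
    proof (intro subset_antisym subsetI)
      fix U assume U: "U \<in> ?L"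
      then obtain V where V: "U = False # V" by (auto simp: list_all2_Cons2)
      then have "U = ?F (map Not V)" by (simp add: comp_def)
      moreover have "map Not V \<in> ?W" using U V by (simp add: comp_def)
      ultimately show "U \<in> ?F ` ?W" by blast
    next
      fix U assume "U \<in> ?F ` ?W"
      then show "U \<in> ?L" using rl step.prems by (auto simp: list_all2_replicate_True dest: shift_length)
    qed
    have "num_tilings (remaining t Z)
        = num_tilings (row (lower t) (lo t) (map Not Z) \<union> (row (upper (Suc t)) (lo t) ?X \<union> ?R))"
      unfolding eq using False by (simp add: full_row_def matched_down_def lo_Suc)
    also have "\<dots> = (\<Sum>U | shift False (map Not Z) U \<and> list_all2 (\<longrightarrow>) U ?X.
        num_tilings (row (upper (Suc t)) (lo t) (map2 (\<lambda>x v. x \<and> \<not> v) ?X U) \<union> ?R))"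
      using step.prems rl by (intro num_tilings_gap_region) simp
    also have "\<dots> = (\<Sum>W\<in>?W. num_tilings (row (upper (Suc t)) (lo t) (map2 (\<lambda>x v. x \<and> \<not> v) ?X (?F W)) \<union> ?R))"
      unfolding set by (subst sum.reindex) (auto intro!: inj_onI simp: inj_map_eq_map inj_def)
    also have "\<dots> = (\<Sum>W\<in>?W. walks (steps (Suc t)) W)"
    proof (rule sum.cong[OF refl])
      fix W assume "W \<in> ?W"
      then have l: "length W = row_length (Suc t)"
        using rl step.prems by (auto dest: shift_length)
      then show "num_tilings (row (upper (Suc t)) (lo t) (map2 (\<lambda>x v. x \<and> \<not> v) ?X (?F W)) \<union> ?R) = walks (steps (Suc t)) W"
        using step.IH[OF l] False by (simp add: map2_replicate_True remaining_def matched_up_def lo_Suc del: map_map)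
    qed
    also have "\<dots> = walks (steps t) Z"
      using False step.hyps by (simp add: steps_Suc)
    finally show ?thesis .
  qed
qed

section \<open>Evaluation of the number of tilings and of regular cells\<close>

lemma row_length_0: "row_length 0 = a"
  by (simp add: row_length_def lo_def hi_def)

text \<open>The white squares crossed by \<open>l\<close> have nothing above them, so all of them
  are matched downwards and the initial state is full.\<close>

lemma num_tilings_douglas: "num_tilings (douglas A a ds) = walks (steps 0) (replicate a True)"
proof -
  have "douglas A a ds = remaining 0 (replicate a True)"
    using not_upper_black_0 not_drawn_0
    by (simp add: douglas_eq below_Suc remaining_def matched_up_def full_row_def row_length_0)
  then show ?thesis
    using num_tilings_remaining[of 0] by (simp add: row_length_0)
qed

lemma count_list_steps: "count_list (steps 0) True = east n" "count_list (steps 0) False = south n"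
proof -
  have "count_list (map (\<lambda>s. upper_black (Suc s)) [0..<t]) True = east t"
    and "count_list (map (\<lambda>s. upper_black (Suc s)) [0..<t]) False = south t" for t
    by (induction t) auto
  then show "count_list (steps 0) True = east n" "count_list (steps 0) False = south n"
    by (simp_all add: steps_def)
qed

lemma regular_upper: "regular A ds (upper t i) \<longleftrightarrow> upper_black t"
  and regular_lower: "drawn t \<Longrightarrow> \<not> regular A ds (lower t i)"
  using black_cell_top[of i "i - lev0 A - int t" t]
  by (auto simp: upper_eq lower_eq cell_top_def drawn_def split: if_splits)

lemma num_regular_eq: "num_regular A a ds = (\<Sum>t | t \<le> n \<and> upper_black t. row_length t)"
proof -
  have "{c \<in> douglas A a ds. regular A ds c} = (\<Union>t\<in>{t. t \<le> n \<and> upper_black t}. upper t ` {lo t..<hi t})"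
    by (auto simp: douglas_eq below_def lower_part_def full_row_eq regular_upper regular_lower)
  moreover have "card (upper t ` {lo t..<hi t}) = row_length t" for t
    by (subst card_image) (auto simp: row_length_def inj_on_def)
  ultimately show ?thesis
    by (simp add: num_regular_def) (subst card_UN_disjoint, auto)
qed

lemma sum_row_length: "t \<le> n \<Longrightarrow> (\<Sum>s | t < s \<and> s \<le> n \<and> upper_black s. row_length s) = regular_count (row_length t) (steps t)"
proof (induction t rule: inc_induct)
  case base
  then show ?case by (simp add: steps_def)
next
  case (step t)
  have "{s. t < s \<and> s \<le> n \<and> upper_black s}
      = (if upper_black (Suc t) then insert (Suc t) {s. Suc t < s \<and> s \<le> n \<and> upper_black s}
         else {s. Suc t < s \<and> s \<le> n \<and> upper_black s})"
    using step.hyps by (auto simp: less_Suc_eq Suc_lessI) (metis Suc_lessI)+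
  then show ?case
    using step by (cases "upper_black (Suc t)") (simp_all add: steps_Suc row_length_Suc)
qed

lemma num_regular_steps: "num_regular A a ds = regular_count a (steps 0)"
proof -
  have "{t. t \<le> n \<and> upper_black t} = {t. 0 < t \<and> t \<le> n \<and> upper_black t}"
    using not_upper_black_0 by (auto intro: gr0I)
  then show ?thesis
    using sum_row_length[of 0] by (simp add: num_regular_eq row_length_0)
qed

lemma num_tilings_inversions: "num_tilings (douglas A a ds) = 2 ^ inversions 0 (steps 0)"
  using walks_full[of "steps 0" a 0] by (simp add: num_tilings_douglas count_list_steps south_n)

lemma num_regular_inversions:
  "2 * num_regular A a ds = width A a ds * (width A a ds + 1) + 2 * inversions 0 (steps 0)"
  using regular_count_inversions[of "steps 0" 0]
  by (simp add: num_regular_steps count_list_steps south_n width_eq)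

end

theorem theorem1p1:
  fixes A :: "int \<times> int" and a :: nat and ds :: "nat list"
  assumes a_pos: "a > 0"
    and k_pos: "ds \<noteq> []"
    and d_pos: "\<forall>d \<in> set ds. d > 0"
    and l'_white: "\<forall>i j. i - j = lev0 A + int (sum_list ds) \<longrightarrow> \<not> black A ds (Sq i j)"
    and no_intersect: "ne_point A ds ` {0..sum_list ds} \<inter> sw_point A a ds ` {0..sum_list ds} = {}"
    and B_D_horizontal: "snd (vB A ds) = snd (vD A a)"
  shows "real (num_tilings (douglas A a ds))
           = 2 powr (real (num_regular A a ds) - real (width A a ds) * (real (width A a ds) + 1) / 2)"
proof -
  interpret douglas_region A a ds
    using a_pos k_pos d_pos l'_white B_D_horizontal by unfold_locales
  \<comment> \<open>The doubled identity avoids halving in the natural numbers; over the reals it is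
    solved for the exponent.\<close>
  have "real (2 * num_regular A a ds) = real (width A a ds * (width A a ds + 1) + 2 * inversions 0 (steps 0))"
    by (simp only: num_regular_inversions)
  then have "real (num_regular A a ds) - real (width A a ds) * (real (width A a ds) + 1) / 2
      = real (inversions 0 (steps 0))"
    by (simp add: field_simps)
  then show ?thesis
    by (simp add: num_tilings_inversions powr_realpow)
qed

end
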